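(* The logic $KG$ (and hence also $KG_\Diamond$) is complete with respect to the class of $\langle\Diamond,1\rangle$-witnessed crisp Gödel–Kripke models. In particular, for every formula $\rho$, the canonical model $\mathfrak M^\Omega$ with $\Omega$ the set of subformulas of $\rho$ is $\langle\Diamond,1\rangle$-witnessed on $\Omega$: for every $h\in W$ and every $\Diamond\psi\in\Omega$ with $e(h,\Diamond\psi)=1$ there is $g\in W$ with $Rhg$ and $e(g,\psi)=1$.
   Context: Standard Gödel algebra $[0,1]_G$: $a\wedge b=\min$, $a\vee b=\max$, $a\rightarrow b=1$ if $a\le b$, else $b$; $\neg a=a\rightarrow0$. Formulas are built from propositional variables and $\bot$ with $\wedge,\vee,\rightarrow,\Box,\Diamond$ ($\neg\varphi:=\varphi\rightarrow\bot$, $\top:=\neg\bot$). A Gödel–Kripke model is $\langle W,R,e\rangle$, $W\ne\emptyset$, $R\colon W\times W\to[0,1]$, $e$ assigning to each world and variable a value in $[0,1]$, extended world-wise as a homomorphism into $[0,1]_G$, with $e(v,\Box\varphi)=\bigwedge_w(R(v,w)\rightarrow e(w,\varphi))$ and $e(v,\Diamond\varphi)=\bigvee_w(R(v,w)\wedge e(w,\varphi))$. It is crisp if $R$ takes values in $\{0,1\}$ (write $Rvw$ for $R(v,w)=1$). A crisp model is $\langle\Diamond,1\rangle$-witnessed if whenever $e(v,\Diamond\varphi)=1$ there is $w$ with $Rvw$ and $e(w,\varphi)=1$. $KG$ is the Hilbert system with: axioms of Gödel–Dummett propositional logic; $\Box(\varphi\rightarrow\psi)\rightarrow(\Box\varphi\rightarrow\Box\psi)$;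 $\neg\neg\Box\varphi\rightarrow\Box\neg\neg\varphi$; $\Diamond(\varphi\vee\psi)\rightarrow(\Diamond\varphi\vee\Diamond\psi)$; $\Diamond\neg\neg\varphi\rightarrow\neg\neg\Diamond\varphi$; $\neg\Diamond\bot$; $\Diamond(\varphi\rightarrow\psi)\rightarrow(\Box\varphi\rightarrow\Diamond\psi)$; $(\Diamond\varphi\rightarrow\Box\psi)\rightarrow\Box(\varphi\rightarrow\psi)$; $\Box(\varphi\vee\psi)\rightarrow(\Box\varphi\vee\Diamond\psi)$; modus ponens; from a theorem $\varphi$ infer $\Box\varphi$; from a theorem $\varphi\rightarrow\psi$ infer $\Diamond\varphi\rightarrow\Diamond\psi$. $KG_\Diamond$ is the $\Diamond$-only system: Gödel–Dummett axioms, $\Diamond(\varphi\vee\psi)\rightarrow(\Diamond\varphi\vee\Diamond\psi)$, $\Diamond\neg\neg\varphi\rightarrow\neg\neg\Diamond\varphi$, $\neg\Diamond\bot$, modus ponens, and: from a theorem $(\varphi\rightarrow\psi)\vee\chi$ infer $(\Diamond\varphi\rightarrow\Diamond\psi)\vee\Diamond\chi$. Consequence is local ($\Gamma\vdash_L\varphi$ iff derivable by modus ponens from $\Gamma$ and theorems of $L$). $L$ is complete w.r.t. a class $\mathcal C$ if, for all $\Gamma\cup\{\varphi\}$ in the language of $L$, $\Gamma\vdash_L\varphi$ iff for all models in $\mathcal C$ and worlds $v$, $e(v,\gamma)=1$ for all $\gamma\in\Gamma$ implies $e(v,\varphi)=1$. Canonical model $\mathfrak M^\Omega$: $W$ is the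 set of homomorphisms $h$ from the formula algebra into $[0,1]_G$ with $h(\theta)=1$ for all theorems $\theta$ of $KG$; $e(h,p)=h(p)$; $Rhg$ iff $h(\Box\varphi)\le g(\varphi)$ for all $\Box\varphi\in\Omega$ and $g(\varphi)\le h(\Diamond\varphi)$ for all $\Diamond\varphi\in\Omega$. *)

theory Defs
  imports Complex_Main
begin

section \<open>Formulas\<close>

text \<open>The set of propositional variables is countably infinite. (For uncountably many variables,
  completeness for arbitrary sets of premises already fails for propositional Goedel logic
  over the real unit interval.)\<close>

datatype fm =
    Var nat
  | Bot ("\<^bold>\<bottom>")
  | And fm fm (infixr "\<^bold>\<and>" 70)
  | Or fm fm (infixr "\<^bold>\<or>" 65)
  | Imp fm fm (infixr "\<^bold>\<rightarrow>" 60)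
  | Box fm ("\<^bold>\<box> _" [90] 90)
  | Dia fm ("\<^bold>\<diamond> _" [90] 90)

abbreviation Neg :: "fm \<Rightarrow> fm" ("\<^bold>\<not> _" [90] 90) where
  "\<^bold>\<not> \<phi> \<equiv> \<phi> \<^bold>\<rightarrow> \<^bold>\<bottom>"

primrec subfms :: "fm \<Rightarrow> fm set" where
  "subfms (Var p) = {Var p}"
| "subfms \<^bold>\<bottom> = {\<^bold>\<bottom>}"
| "subfms (\<phi> \<^bold>\<and> \<psi>) = insert (\<phi> \<^bold>\<and> \<psi>) (subfms \<phi> \<union> subfms \<psi>)"
| "subfms (\<phi> \<^bold>\<or> \<psi>) = insert (\<phi> \<^bold>\<or> \<psi>) (subfms \<phi> \<union> subfms \<psi>)"
| "subfms (\<phi> \<^bold>\<rightarrow> \<psi>) = insert (\<phi> \<^bold>\<rightarrow> \<psi>) (subfms \<phi> \<union> subfms \<psi>)"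
| "subfms (\<^bold>\<box> \<phi>) = insert (\<^bold>\<box> \<phi>) (subfms \<phi>)"
| "subfms (\<^bold>\<diamond> \<phi>) = insert (\<^bold>\<diamond> \<phi>) (subfms \<phi>)"

definition dia_language :: "fm set" where
  "dia_language = {\<phi>. \<forall>\<psi>. \<^bold>\<box> \<psi> \<notin> subfms \<phi>}"

section \<open>Goedel--Kripke models\<close>

definition gimp :: "real \<Rightarrow> real \<Rightarrow> real" where
  "gimp a b = (if a \<le> b then 1 else b)"

record 'w gk_model =
  worlds :: "'w set"
  rel :: "'w \<Rightarrow> 'w \<Rightarrow> real"
  val :: "'w \<Rightarrow> nat \<Rightarrow> real"

definition is_gk_model :: "'w gk_model \<Rightarrow> bool" where
  "is_gk_model M \<longleftrightarrow> worlds M \<noteq> {}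
     \<and> (\<forall>v\<in>worlds M. \<forall>w\<in>worlds M. rel M v w \<in> {0..1})
     \<and> (\<forall>v\<in>worlds M. \<forall>p. val M v p \<in> {0..1})"

text \<open>In a Goedel--Kripke model the infima and suprema below range over nonempty subsets of
  the unit interval, so the conditionally complete operations on the reals agree with those of
  the complete lattice \<open>[0,1]\<close>.\<close>

primrec eval :: "'w gk_model \<Rightarrow> fm \<Rightarrow> 'w \<Rightarrow> real" where
  "eval M (Var p) v = val M v p"
| "eval M \<^bold>\<bottom> v = 0"
| "eval M (\<phi> \<^bold>\<and> \<psi>) v = min (eval M \<phi> v) (eval M \<psi> v)"
| "eval M (\<phi> \<^bold>\<or> \<psi>) v = max (eval M \<phi> v) (eval M \<psi> v)"
| "eval M (\<phi> \<^bold>\<rightarrow> \<psi>) v = gimp (eval M \<phi> v) (eval M \<psi> v)"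
| "eval M (\<^bold>\<box> \<phi>) v = (INF w\<in>worlds M. gimp (rel M v w) (eval M \<phi> w))"
| "eval M (\<^bold>\<diamond> \<phi>) v = (SUP w\<in>worlds M. min (rel M v w) (eval M \<phi> w))"

definition crisp :: "'w gk_model \<Rightarrow> bool" where
  "crisp M \<longleftrightarrow> (\<forall>v\<in>worlds M. \<forall>w\<in>worlds M. rel M v w \<in> {0, 1})"

definition dia1_witnessed_on :: "fm set \<Rightarrow> 'w gk_model \<Rightarrow> bool" where
  "dia1_witnessed_on \<Omega> M \<longleftrightarrow>
     (\<forall>v\<in>worlds M. \<forall>\<psi>. \<^bold>\<diamond> \<psi> \<in> \<Omega> \<longrightarrow> eval M (\<^bold>\<diamond> \<psi>) v = 1 \<longrightarrow>
        (\<exists>w\<in>worlds M. rel M v w = 1 \<and> eval M \<psi> w = 1))"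

definition dia1_witnessed_crisp_models :: "'w gk_model set" where
  "dia1_witnessed_crisp_models = {M. is_gk_model M \<and> crisp M \<and> dia1_witnessed_on UNIV M}"

section \<open>The Hilbert systems\<close>

text \<open>Intuitionistic propositional logic plus prelinearity.\<close>

inductive goedel_axiom :: "fm \<Rightarrow> bool" where
  "goedel_axiom (\<phi> \<^bold>\<rightarrow> (\<psi> \<^bold>\<rightarrow> \<phi>))"
| "goedel_axiom ((\<phi> \<^bold>\<rightarrow> (\<psi> \<^bold>\<rightarrow> \<chi>)) \<^bold>\<rightarrow> ((\<phi> \<^bold>\<rightarrow> \<psi>) \<^bold>\<rightarrow> (\<phi> \<^bold>\<rightarrow> \<chi>)))"
| "goedel_axiom ((\<phi> \<^bold>\<and> \<psi>) \<^bold>\<rightarrow> \<phi>)"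
| "goedel_axiom ((\<phi> \<^bold>\<and> \<psi>) \<^bold>\<rightarrow> \<psi>)"
| "goedel_axiom (\<phi> \<^bold>\<rightarrow> (\<psi> \<^bold>\<rightarrow> (\<phi> \<^bold>\<and> \<psi>)))"
| "goedel_axiom (\<phi> \<^bold>\<rightarrow> (\<phi> \<^bold>\<or> \<psi>))"
| "goedel_axiom (\<psi> \<^bold>\<rightarrow> (\<phi> \<^bold>\<or> \<psi>))"
| "goedel_axiom ((\<phi> \<^bold>\<rightarrow> \<chi>) \<^bold>\<rightarrow> ((\<psi> \<^bold>\<rightarrow> \<chi>) \<^bold>\<rightarrow> ((\<phi> \<^bold>\<or> \<psi>) \<^bold>\<rightarrow> \<chi>)))"
| "goedel_axiom (\<^bold>\<bottom> \<^bold>\<rightarrow> \<phi>)"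
| "goedel_axiom ((\<phi> \<^bold>\<rightarrow> \<psi>) \<^bold>\<or> (\<psi> \<^bold>\<rightarrow> \<phi>))"

inductive KG :: "fm \<Rightarrow> bool" where
  KG_goedel: "goedel_axiom \<phi> \<Longrightarrow> KG \<phi>"
| KG_K_box: "KG (\<^bold>\<box> (\<phi> \<^bold>\<rightarrow> \<psi>) \<^bold>\<rightarrow> (\<^bold>\<box> \<phi> \<^bold>\<rightarrow> \<^bold>\<box> \<psi>))"
| KG_Z_box: "KG (\<^bold>\<not> \<^bold>\<not> \<^bold>\<box> \<phi> \<^bold>\<rightarrow> \<^bold>\<box> \<^bold>\<not> \<^bold>\<not> \<phi>)"
| KG_D_dia: "KG (\<^bold>\<diamond> (\<phi> \<^bold>\<or> \<psi>) \<^bold>\<rightarrow> (\<^bold>\<diamond> \<phi> \<^bold>\<or> \<^bold>\<diamond> \<psi>))"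
| KG_Z_dia: "KG (\<^bold>\<diamond> \<^bold>\<not> \<^bold>\<not> \<phi> \<^bold>\<rightarrow> \<^bold>\<not> \<^bold>\<not> \<^bold>\<diamond> \<phi>)"
| KG_F_dia: "KG (\<^bold>\<not> \<^bold>\<diamond> \<^bold>\<bottom>)"
| KG_FS1: "KG (\<^bold>\<diamond> (\<phi> \<^bold>\<rightarrow> \<psi>) \<^bold>\<rightarrow> (\<^bold>\<box> \<phi> \<^bold>\<rightarrow> \<^bold>\<diamond> \<psi>))"
| KG_FS2: "KG ((\<^bold>\<diamond> \<phi> \<^bold>\<rightarrow> \<^bold>\<box> \<psi>) \<^bold>\<rightarrow> \<^bold>\<box> (\<phi> \<^bold>\<rightarrow> \<psi>))"
| KG_Dunn: "KG (\<^bold>\<box> (\<phi> \<^bold>\<or> \<psi>) \<^bold>\<rightarrow> (\<^bold>\<box> \<phi> \<^bold>\<or> \<^bold>\<diamond> \<psi>))"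
| KG_MP: "KG (\<phi> \<^bold>\<rightarrow> \<psi>) \<Longrightarrow> KG \<phi> \<Longrightarrow> KG \<psi>"
| KG_nec_box: "KG \<phi> \<Longrightarrow> KG (\<^bold>\<box> \<phi>)"
| KG_mono_dia: "KG (\<phi> \<^bold>\<rightarrow> \<psi>) \<Longrightarrow> KG (\<^bold>\<diamond> \<phi> \<^bold>\<rightarrow> \<^bold>\<diamond> \<psi>)"

text \<open>Axiom instances are restricted to the \<open>\<diamond>\<close>-language; the rules stay inside it.\<close>

inductive KG_dia :: "fm \<Rightarrow> bool" where
  KGd_goedel: "goedel_axiom \<phi> \<Longrightarrow> \<phi> \<in> dia_language \<Longrightarrow> KG_dia \<phi>"
| KGd_D_dia: "\<phi> \<in> dia_language \<Longrightarrow> \<psi> \<in> dia_language \<Longrightarrow>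
    KG_dia (\<^bold>\<diamond> (\<phi> \<^bold>\<or> \<psi>) \<^bold>\<rightarrow> (\<^bold>\<diamond> \<phi> \<^bold>\<or> \<^bold>\<diamond> \<psi>))"
| KGd_Z_dia: "\<phi> \<in> dia_language \<Longrightarrow> KG_dia (\<^bold>\<diamond> \<^bold>\<not> \<^bold>\<not> \<phi> \<^bold>\<rightarrow> \<^bold>\<not> \<^bold>\<not> \<^bold>\<diamond> \<phi>)"
| KGd_F_dia: "KG_dia (\<^bold>\<not> \<^bold>\<diamond> \<^bold>\<bottom>)"
| KGd_MP: "KG_dia (\<phi> \<^bold>\<rightarrow> \<psi>) \<Longrightarrow> KG_dia \<phi> \<Longrightarrow> KG_dia \<psi>"
| KGd_rule: "KG_dia ((\<phi> \<^bold>\<rightarrow> \<psi>) \<^bold>\<or> \<chi>) \<Longrightarrow> KG_dia ((\<^bold>\<diamond> \<phi> \<^bold>\<rightarrow> \<^bold>\<diamond> \<psi>) \<^bold>\<or> \<^bold>\<diamond> \<chi>)"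

text \<open>Local consequence of a logic given by its theorems \<open>L\<close>.\<close>

inductive derives :: "(fm \<Rightarrow> bool) \<Rightarrow> fm set \<Rightarrow> fm \<Rightarrow> bool" for L \<Gamma> where
  derives_premise: "\<phi> \<in> \<Gamma> \<Longrightarrow> derives L \<Gamma> \<phi>"
| derives_theorem: "L \<phi> \<Longrightarrow> derives L \<Gamma> \<phi>"
| derives_MP: "derives L \<Gamma> (\<phi> \<^bold>\<rightarrow> \<psi>) \<Longrightarrow> derives L \<Gamma> \<phi> \<Longrightarrow> derives L \<Gamma> \<psi>"

section \<open>Completeness\<close>

text \<open>A class of models is rendered as a set of models over one type of worlds. To cover models
  with arbitrary sets of worlds, \<open>complete_wrt\<close> is to be used at a world type large enough for all
  countermodels, together with \<open>sound_wrt\<close> at an arbitrary world type.\<close>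

definition consequence :: "'w gk_model set \<Rightarrow> fm set \<Rightarrow> fm \<Rightarrow> bool" where
  "consequence \<C> \<Gamma> \<phi> \<longleftrightarrow>
     (\<forall>M\<in>\<C>. \<forall>v\<in>worlds M. (\<forall>\<gamma>\<in>\<Gamma>. eval M \<gamma> v = 1) \<longrightarrow> eval M \<phi> v = 1)"

definition sound_wrt :: "(fm \<Rightarrow> bool) \<Rightarrow> fm set \<Rightarrow> 'w gk_model set \<Rightarrow> bool" where
  "sound_wrt L Lang \<C> \<longleftrightarrow>
     (\<forall>\<Gamma> \<phi>. \<Gamma> \<subseteq> Lang \<longrightarrow> \<phi> \<in> Lang \<longrightarrow> derives L \<Gamma> \<phi> \<longrightarrow> consequence \<C> \<Gamma> \<phi>)"

definition complete_wrt :: "(fm \<Rightarrow> bool) \<Rightarrow> fm set \<Rightarrow> 'w gk_model set \<Rightarrow> bool" where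
  "complete_wrt L Lang \<C> \<longleftrightarrow>
     (\<forall>\<Gamma> \<phi>. \<Gamma> \<subseteq> Lang \<longrightarrow> \<phi> \<in> Lang \<longrightarrow> (derives L \<Gamma> \<phi> \<longleftrightarrow> consequence \<C> \<Gamma> \<phi>))"

section \<open>The canonical model\<close>

text \<open>Modal formulas act as free generators: nothing is required of the values at
  \<open>\<box>\<phi>\<close> and \<open>\<diamond>\<phi>\<close>.\<close>

definition goedel_hom :: "(fm \<Rightarrow> real) \<Rightarrow> bool" where
  "goedel_hom h \<longleftrightarrow> range h \<subseteq> {0..1} \<and> h \<^bold>\<bottom> = 0
     \<and> (\<forall>\<phi> \<psi>. h (\<phi> \<^bold>\<and> \<psi>) = min (h \<phi>) (h \<psi>))
     \<and> (\<forall>\<phi> \<psi>. h (\<phi> \<^bold>\<or> \<psi>) = max (h \<phi>) (h \<psi>))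
     \<and> (\<forall>\<phi> \<psi>. h (\<phi> \<^bold>\<rightarrow> \<psi>) = gimp (h \<phi>) (h \<psi>))"

definition canonical_model :: "fm set \<Rightarrow> (fm \<Rightarrow> real) gk_model" where
  "canonical_model \<Omega> =
     \<lparr>worlds = {h. goedel_hom h \<and> (\<forall>\<theta>. KG \<theta> \<longrightarrow> h \<theta> = 1)},
      rel = (\<lambda>h g. if (\<forall>\<phi>. \<^bold>\<box> \<phi> \<in> \<Omega> \<longrightarrow> h (\<^bold>\<box> \<phi>) \<le> g \<phi>)
                    \<and> (\<forall>\<phi>. \<^bold>\<diamond> \<phi> \<in> \<Omega> \<longrightarrow> g \<phi> \<le> h (\<^bold>\<diamond> \<phi>)) then 1 else 0),
      val = (\<lambda>h p. h (Var p))\<rparr>"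

end

theory Submission
  imports Defs "HOL-Library.Countable" "HOL-Library.Diagonal_Subsequence" "HOL-Library.Infinite_Set"
begin

text \<open>
  For finite \<open>\<Omega>\<close> and a world \<open>h\<close> of the canonical model, a successor \<open>g\<close> with prescribed
  behaviour at \<open>\<phi>\<close> is sought as \<open>s \<circ> u\<close> with \<open>u\<close> a homomorphism respecting the theorems and \<open>s\<close> a
  strictly increasing map of the unit interval. Such an \<open>s\<close> exists as soon as \<open>u\<close> satisfies finitely
  many equations \<open>u \<theta> = 1\<close>, all with \<open>h (\<box>\<theta>) = 1\<close>, and finitely many strict inequalities
  \<open>u \<upsilon> < 1\<close>. If no \<open>u\<close> did, strong completeness of propositional Goedel logic would turn this into
  a theorem, and the modal axioms would then give a false statement about \<open>h\<close>. Requiring in addition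
  \<open>u \<phi> = 1\<close> costs nothing when \<open>h (\<diamond>\<phi>) = 1\<close>, which yields the witnesses.

  This argument is confined to finite \<open>\<Omega>\<close>. For arbitrary premises one lets \<open>\<Omega>\<close> grow to the
  set of all formulas and passes to a limit: a countable family of sequences of worlds and truth
  values, closed under choosing successors, is compared along a subsequence deciding all inequalities
  between truth values. The resulting countable dense chain is embedded into the unit interval with
  preservation of the relevant suprema and infima.

  For the \<open>\<diamond>\<close>-fragment the same construction yields a crisp countermodel, so by soundness
  \<open>KG\<close> does not derive the formula either, and a witnessed countermodel is obtained from \<open>KG\<close>.
\<close>

section \<open>Soundness\<close>

lemma gimp_in_unit: "b \<in> {0..1} \<Longrightarrow> gimp a b \<in> {0..1}"
  by (simp add: gimp_def)

lemma gimp_eq_1_iff: "a \<le> 1 \<Longrightarrow> gimp a b = 1 \<longleftrightarrow> a \<le> b"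
  by (auto simp: gimp_def)

text \<open>Residuation of \<open>gimp\<close> with respect to \<open>min\<close>; it turns nested
  implications in the axioms into inequalities between minima.\<close>

lemma le_gimp_iff: "c \<le> 1 \<Longrightarrow> c \<le> gimp a b \<longleftrightarrow> min c a \<le> b"
  by (auto simp: gimp_def min_def)

context
  fixes M :: "'w gk_model"
  assumes gk: "is_gk_model M"
begin

lemma eval_in_unit: "v \<in> worlds M \<Longrightarrow> eval M \<phi> v \<in> {0..1}"
proof (induction \<phi> arbitrary: v)
  case (Var x)
  then show ?case using gk by (simp add: is_gk_model_def)
next
  case (Imp \<phi> \<psi>)
  then show ?case by (simp add: gimp_def)
next
  case (Box \<phi>)
  have b: "gimp (rel M v w) (eval M \<phi> w) \<in> {0..1}" if "w \<in> worlds M" for w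
    using Box.IH[OF that] by (rule gimp_in_unit)
  have "(INF w\<in>worlds M. gimp (rel M v w) (eval M \<phi> w)) \<le> gimp (rel M v v) (eval M \<phi> v)"
    by (rule cINF_lower) (use b Box.prems in \<open>auto intro!: bdd_belowI2[where m = 0]\<close>)
  moreover have "0 \<le> (INF w\<in>worlds M. gimp (rel M v w) (eval M \<phi> w))"
    by (rule cINF_greatest) (use b Box.prems in auto)
  ultimately show ?case using b[OF Box.prems] by auto
next
  case (Dia \<phi>)
  have b: "min (rel M v w) (eval M \<phi> w) \<in> {0..1}" if "w \<in> worlds M" for w
    using Dia.IH[OF that] Dia.prems that gk by (auto simp: is_gk_model_def min_def)
  have "min (rel M v v) (eval M \<phi> v) \<le> (SUP w\<in>worlds M. min (rel M v w) (eval M \<phi> w))"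
    by (rule cSUP_upper) (use b Dia.prems in \<open>auto intro!: bdd_aboveI2[where M = 1] simp: min_le_iff_disj\<close>)
  moreover have "(SUP w\<in>worlds M. min (rel M v w) (eval M \<phi> w)) \<le> 1"
    by (rule cSUP_least) (use b Dia.prems in auto)
  ultimately show ?case using b[OF Dia.prems] by auto
qed (auto simp: min_le_iff_disj le_max_iff_disj)

context
  assumes cr: "crisp M"
begin

lemma eval_Box_le:
  assumes "v \<in> worlds M" "w \<in> worlds M" "rel M v w = 1"
  shows "eval M (\<^bold>\<box> \<phi>) v \<le> eval M \<phi> w"
proof -
  have "(INF w\<in>worlds M. gimp (rel M v w) (eval M \<phi> w)) \<le> gimp (rel M v w) (eval M \<phi> w)"
    by (rule cINF_lower)
      (use assms eval_in_unit in \<open>auto intro!: bdd_belowI2[where m = 0] simp: gimp_def\<close>)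
  then show ?thesis using assms eval_in_unit[of w \<phi>] by (auto simp: gimp_def split: if_splits)
qed

text \<open>The bound \<open>c \<le> 1\<close> takes care of the worlds that are not successors:
  each contributes \<open>gimp 0 _ = 1\<close> to the infimum. Dually, such worlds contribute 0 to
  the supremum for \<diamond>, whence \<open>0 \<le> c\<close> in
  \<open>eval_Dia_le\<close>.\<close>

lemma le_eval_Box:
  assumes "v \<in> worlds M" "c \<le> 1" "\<And>w. w \<in> worlds M \<Longrightarrow> rel M v w = 1 \<Longrightarrow> c \<le> eval M \<phi> w"
  shows "c \<le> eval M (\<^bold>\<box> \<phi>) v"
  unfolding eval.simps
proof (rule cINF_greatest)
  fix w assume w: "w \<in> worlds M"
  then have "rel M v w = 0 \<or> rel M v w = 1" using cr assms(1) by (auto simp: crisp_def)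
  then show "c \<le> gimp (rel M v w) (eval M \<phi> w)"
    using assms w eval_in_unit[OF w, of \<phi>] by (auto simp: gimp_def)
qed (use assms in auto)

lemma le_eval_Dia:
  assumes "v \<in> worlds M" "w \<in> worlds M" "rel M v w = 1"
  shows "eval M \<phi> w \<le> eval M (\<^bold>\<diamond> \<phi>) v"
proof -
  have "min (rel M v w) (eval M \<phi> w) \<le> (SUP w\<in>worlds M. min (rel M v w) (eval M \<phi> w))"
    by (rule cSUP_upper)
      (use assms eval_in_unit in \<open>auto intro!: bdd_aboveI2[where M = 1] simp: min_le_iff_disj\<close>)
  then show ?thesis using assms eval_in_unit[of w \<phi>] by (auto simp: min_def split: if_splits)
qed

lemma eval_Dia_le:
  assumes "v \<in> worlds M" "0 \<le> c" "\<And>w. w \<in> worlds M \<Longrightarrow> rel M v w = 1 \<Longrightarrow> eval M \<phi> w \<le> c"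
  shows "eval M (\<^bold>\<diamond> \<phi>) v \<le> c"
  unfolding eval.simps
proof (rule cSUP_least)
  fix w assume w: "w \<in> worlds M"
  then have "rel M v w = 0 \<or> rel M v w = 1" using cr assms(1) by (auto simp: crisp_def)
  then show "min (rel M v w) (eval M \<phi> w) \<le> c"
    using assms w eval_in_unit[OF w, of \<phi>] by (auto simp: min_le_iff_disj)
qed (use assms in auto)

section \<open>Validity of axioms and rules in crisp models\<close>

lemma eval_Imp_eq_1:
  "v \<in> worlds M \<Longrightarrow> eval M (\<phi> \<^bold>\<rightarrow> \<psi>) v = 1 \<longleftrightarrow> eval M \<phi> v \<le> eval M \<psi> v"
  using eval_in_unit[of v \<phi>] by (simp add: gimp_eq_1_iff)

lemma eval_goedel_axiom:
  assumes "goedel_axiom \<phi>" "v \<in> worlds M"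
  shows "eval M \<phi> v = 1"
proof -
  have "0 \<le> eval M \<phi> v" "eval M \<phi> v \<le> 1" for \<phi>
    using eval_in_unit[OF assms(2), of \<phi>] by auto
  note b = this
  show ?thesis
    using assms(1)
    by cases (simp_all add: b gimp_def min_def max_def, (smt (verit) b)+)
qed

lemma eval_axiom_D_dia:
  assumes "v \<in> worlds M"
  shows "eval M (\<^bold>\<diamond> (\<phi> \<^bold>\<or> \<psi>) \<^bold>\<rightarrow> (\<^bold>\<diamond> \<phi> \<^bold>\<or> \<^bold>\<diamond> \<psi>)) v = 1"
  unfolding eval_Imp_eq_1[OF assms]
proof (rule eval_Dia_le[OF assms])
  show "0 \<le> eval M (\<^bold>\<diamond> \<phi> \<^bold>\<or> \<^bold>\<diamond> \<psi>) v" using eval_in_unit[OF assms] by (metis atLeastAtMost_iff)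
  fix w assume "w \<in> worlds M" "rel M v w = 1"
  then show "eval M (\<phi> \<^bold>\<or> \<psi>) w \<le> eval M (\<^bold>\<diamond> \<phi> \<^bold>\<or> \<^bold>\<diamond> \<psi>) v"
    using le_eval_Dia[OF assms, of w \<phi>] le_eval_Dia[OF assms, of w \<psi>]
    by (auto simp add: le_max_iff_disj simp del: eval.simps(6,7))
qed

lemma eval_axiom_Z_dia:
  assumes "v \<in> worlds M"
  shows "eval M (\<^bold>\<diamond> \<^bold>\<not> \<^bold>\<not> \<phi> \<^bold>\<rightarrow> \<^bold>\<not> \<^bold>\<not> \<^bold>\<diamond> \<phi>) v = 1"
  unfolding eval_Imp_eq_1[OF assms]
proof (rule eval_Dia_le[OF assms])
  show "0 \<le> eval M (\<^bold>\<not> \<^bold>\<not> \<^bold>\<diamond> \<phi>) v" using eval_in_unit[OF assms] by (metis atLeastAtMost_iff)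
  fix w assume "w \<in> worlds M" "rel M v w = 1"
  then show "eval M (\<^bold>\<not> \<^bold>\<not> \<phi>) w \<le> eval M (\<^bold>\<not> \<^bold>\<not> \<^bold>\<diamond> \<phi>) v"
    using le_eval_Dia[OF assms, of w \<phi>] eval_in_unit[of w \<phi>]
    by (simp add: gimp_def del: eval.simps(6,7))
qed

lemma eval_axiom_F_dia:
  assumes "v \<in> worlds M"
  shows "eval M (\<^bold>\<not> \<^bold>\<diamond> \<^bold>\<bottom>) v = 1"
  unfolding eval_Imp_eq_1[OF assms] by (rule eval_Dia_le[OF assms]) auto

lemma KG_sound:
  assumes "KG \<theta>" "v \<in> worlds M"
  shows "eval M \<theta> v = 1"
  using assms
proof (induction arbitrary: v)
  case (KG_goedel \<phi>)
  then show ?case by (rule eval_goedel_axiom)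
next
  case (KG_K_box \<phi> \<psi>)
  note v = KG_K_box
  let ?b = "\<lambda>\<chi>. eval M (\<^bold>\<box> \<chi>) v"
  have "min (?b (\<phi> \<^bold>\<rightarrow> \<psi>)) (?b \<phi>) \<le> ?b \<psi>"
  proof (rule le_eval_Box[OF v])
    show "min (?b (\<phi> \<^bold>\<rightarrow> \<psi>)) (?b \<phi>) \<le> 1" using eval_in_unit[OF v, of "\<^bold>\<box> \<phi>"] by (simp add: min_le_iff_disj)
    fix w assume w: "w \<in> worlds M" "rel M v w = 1"
    show "min (?b (\<phi> \<^bold>\<rightarrow> \<psi>)) (?b \<phi>) \<le> eval M \<psi> w"
      using eval_Box_le[OF v w, of \<phi>] eval_Box_le[OF v w, of "\<phi> \<^bold>\<rightarrow> \<psi>"]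
      by (auto simp: gimp_def min_def simp del: eval.simps(6,7) split: if_splits)
  qed
  then show ?case using eval_in_unit[OF v, of "\<^bold>\<box> (\<phi> \<^bold>\<rightarrow> \<psi>)"]
    unfolding eval_Imp_eq_1[OF v] by (simp add: le_gimp_iff del: eval.simps(6,7))
next
  case (KG_Z_box \<phi>)
  note v = KG_Z_box
  show ?case unfolding eval_Imp_eq_1[OF v]
  proof (rule le_eval_Box[OF v])
    show "eval M (\<^bold>\<not> \<^bold>\<not> \<^bold>\<box> \<phi>) v \<le> 1" using eval_in_unit[OF v] by (metis atLeastAtMost_iff)
    fix w assume w: "w \<in> worlds M" "rel M v w = 1"
    show "eval M (\<^bold>\<not> \<^bold>\<not> \<^bold>\<box> \<phi>) v \<le> eval M (\<^bold>\<not> \<^bold>\<not> \<phi>) w"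
      using eval_Box_le[OF v w, of \<phi>] by (simp add: gimp_def del: eval.simps(6,7))
  qed
next
  case (KG_D_dia \<phi> \<psi>)
  then show ?case by (rule eval_axiom_D_dia)
next
  case (KG_Z_dia \<phi>)
  then show ?case by (rule eval_axiom_Z_dia)
next
  case KG_F_dia
  then show ?case by (rule eval_axiom_F_dia)
next
  case (KG_FS1 \<phi> \<psi>)
  note v = KG_FS1
  show ?case unfolding eval_Imp_eq_1[OF v]
  proof (rule eval_Dia_le[OF v])
    show "0 \<le> eval M (\<^bold>\<box> \<phi> \<^bold>\<rightarrow> \<^bold>\<diamond> \<psi>) v" using eval_in_unit[OF v] by (metis atLeastAtMost_iff)
    fix w assume w: "w \<in> worlds M" "rel M v w = 1"
    show "eval M (\<phi> \<^bold>\<rightarrow> \<psi>) w \<le> eval M (\<^bold>\<box> \<phi> \<^bold>\<rightarrow> \<^bold>\<diamond> \<psi>) v"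
      using eval_Box_le[OF v w, of \<phi>] le_eval_Dia[OF v w, of \<psi>] eval_in_unit[OF w(1), of \<psi>]
      by (auto simp: gimp_def simp del: eval.simps(6,7))
  qed
next
  case (KG_FS2 \<phi> \<psi>)
  note v = KG_FS2
  show ?case unfolding eval_Imp_eq_1[OF v]
  proof (rule le_eval_Box[OF v])
    show "eval M (\<^bold>\<diamond> \<phi> \<^bold>\<rightarrow> \<^bold>\<box> \<psi>) v \<le> 1" using eval_in_unit[OF v] by (metis atLeastAtMost_iff)
    fix w assume w: "w \<in> worlds M" "rel M v w = 1"
    show "eval M (\<^bold>\<diamond> \<phi> \<^bold>\<rightarrow> \<^bold>\<box> \<psi>) v \<le> eval M (\<phi> \<^bold>\<rightarrow> \<psi>) w"
      using eval_Box_le[OF v w, of \<psi>] le_eval_Dia[OF v w, of \<phi>] eval_in_unit[OF v, of "\<^bold>\<box> \<psi>"]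
      by (auto simp: gimp_def simp del: eval.simps(6,7))
  qed
next
  case (KG_Dunn \<phi> \<psi>)
  note v = KG_Dunn
  let ?m = "eval M (\<^bold>\<box> (\<phi> \<^bold>\<or> \<psi>)) v"
  \<comment> \<open>Truth values form a chain: once the value of \<diamond>\<psi> is below
    \<open>?m\<close>, no successor reaches \<open>?m\<close> through \<psi>, so every successor
    reaches it through \<phi>.\<close>
  have "?m \<le> eval M (\<^bold>\<box> \<phi>) v" if *: "\<not> ?m \<le> eval M (\<^bold>\<diamond> \<psi>) v"
  proof (rule le_eval_Box[OF v])
    show "?m \<le> 1" using eval_in_unit[OF v] by (metis atLeastAtMost_iff)
    fix w assume w: "w \<in> worlds M" "rel M v w = 1"
    show "?m \<le> eval M \<phi> w"
      using * eval_Box_le[OF v w, of "\<phi> \<^bold>\<or> \<psi>"] le_eval_Dia[OF v w, of \<psi>]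
      by (simp del: eval.simps(6,7) add: le_max_iff_disj)
  qed
  then show ?case unfolding eval_Imp_eq_1[OF v] by (auto simp del: eval.simps(6,7) simp: le_max_iff_disj)
next
  case (KG_MP \<phi> \<psi>)
  then show ?case using eval_Imp_eq_1 eval_in_unit by (metis atLeastAtMost_iff order_antisym)
next
  case (KG_nec_box \<phi>)
  have "1 \<le> eval M (\<^bold>\<box> \<phi>) v" by (rule le_eval_Box) (use KG_nec_box in auto)
  then show ?case using eval_in_unit[OF KG_nec_box.prems, of "\<^bold>\<box> \<phi>"] by simp
next
  case (KG_mono_dia \<phi> \<psi>)
  note v = KG_mono_dia.prems
  have "eval M (\<^bold>\<diamond> \<phi>) v \<le> eval M (\<^bold>\<diamond> \<psi>) v"
  proof (rule eval_Dia_le[OF v])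
    show "0 \<le> eval M (\<^bold>\<diamond> \<psi>) v" using eval_in_unit[OF v] by (metis atLeastAtMost_iff)
    fix w assume w: "w \<in> worlds M" "rel M v w = 1"
    show "eval M \<phi> w \<le> eval M (\<^bold>\<diamond> \<psi>) v"
      using le_eval_Dia[OF v w, of \<psi>] KG_mono_dia.IH[OF w(1)] eval_Imp_eq_1[OF w(1)] by force
  qed
  then show ?case unfolding eval_Imp_eq_1[OF v] .
qed

lemma KG_dia_sound:
  assumes "KG_dia \<theta>" "v \<in> worlds M"
  shows "eval M \<theta> v = 1"
  using assms
proof (induction arbitrary: v)
  case (KGd_goedel \<phi>)
  then show ?case using eval_goedel_axiom by blast
next
  case (KGd_MP \<phi> \<psi>)
  then show ?case using eval_Imp_eq_1 eval_in_unit by (metis atLeastAtMost_iff order_antisym)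
next
  case (KGd_rule \<phi> \<psi> \<chi>)
  note v = KGd_rule.prems
  have u: "0 \<le> eval M \<alpha> w" "eval M \<alpha> w \<le> 1" if "w \<in> worlds M" for \<alpha> w
    using eval_in_unit[OF that] by auto
  have IH: "eval M \<phi> w \<le> eval M \<psi> w \<or> eval M \<chi> w = 1" if "w \<in> worlds M" for w
    using KGd_rule.IH[OF that] eval_Imp_eq_1[OF that, of \<phi> \<psi>] by (auto simp: max_def split: if_splits)
  show ?case
  \<comment> \<open>In a chain a disjunction has value 1 only through one disjunct. Either some
    successor gives \<chi> the value 1, which makes \<diamond>\<chi> true, or every successor
    satisfies the implication.\<close>
  proof (cases "\<exists>w\<in>worlds M. rel M v w = 1 \<and> eval M \<chi> w = 1")
    case True
    then have "eval M (\<^bold>\<diamond> \<chi>) v = 1" using le_eval_Dia[OF v, of _ \<chi>] u(2)[OF v, of "\<^bold>\<diamond> \<chi>"] by force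
    then show ?thesis using u(2)[OF v, of "\<^bold>\<diamond> \<phi> \<^bold>\<rightarrow> \<^bold>\<diamond> \<psi>"] by simp
  next
    case False
    have "eval M (\<^bold>\<diamond> \<phi>) v \<le> eval M (\<^bold>\<diamond> \<psi>) v"
    proof (rule eval_Dia_le[OF v u(1)[OF v]])
      fix w assume w: "w \<in> worlds M" "rel M v w = 1"
      show "eval M \<phi> w \<le> eval M (\<^bold>\<diamond> \<psi>) v"
        using le_eval_Dia[OF v w, of \<psi>] IH[OF w(1)] False w by force
    qed
    then have "eval M (\<^bold>\<diamond> \<phi> \<^bold>\<rightarrow> \<^bold>\<diamond> \<psi>) v = 1" unfolding eval_Imp_eq_1[OF v] .
    then show ?thesis using u(2)[OF v, of "\<^bold>\<diamond> \<chi>"] by simp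
  qed
qed (rule eval_axiom_D_dia eval_axiom_Z_dia eval_axiom_F_dia; assumption)+

lemma derives_sound:
  assumes "derives L \<Gamma> \<phi>" and L: "\<And>\<theta> v. L \<theta> \<Longrightarrow> v \<in> worlds M \<Longrightarrow> eval M \<theta> v = 1"
    and v: "v \<in> worlds M" and \<Gamma>: "\<And>\<gamma>. \<gamma> \<in> \<Gamma> \<Longrightarrow> eval M \<gamma> v = 1"
  shows "eval M \<phi> v = 1"
  using assms(1)
proof induction
  case (derives_MP \<phi> \<psi>)
  then show ?case
    using eval_Imp_eq_1[OF v] eval_in_unit[OF v] by (metis atLeastAtMost_iff order_antisym)
qed (use L v \<Gamma> in blast)+

end

end

lemma sound_wrt_dia1_witnessed_crisp_models:
  assumes "\<And>(M :: 'w gk_model) \<theta> v.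
    is_gk_model M \<Longrightarrow> crisp M \<Longrightarrow> L \<theta> \<Longrightarrow> v \<in> worlds M \<Longrightarrow> eval M \<theta> v = 1"
  shows "sound_wrt L Lang (dia1_witnessed_crisp_models :: 'w gk_model set)"
  unfolding sound_wrt_def consequence_def dia1_witnessed_crisp_models_def
proof (intro allI impI ballI)
  fix \<Gamma> \<phi> v and M :: "'w gk_model"
  assume *: "derives L \<Gamma> \<phi>" "M \<in> {M. is_gk_model M \<and> crisp M \<and> dia1_witnessed_on UNIV M}"
    "v \<in> worlds M" "\<forall>\<gamma>\<in>\<Gamma>. eval M \<gamma> v = 1"
  then have M: "is_gk_model M" "crisp M" by auto
  show "eval M \<phi> v = 1"
    by (rule derives_sound[OF M *(1)]) (use * assms[OF M] in auto)
qed

section \<open>Embedding countable preorders into the unit interval\<close>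

text \<open>Isolates the property behind continuity: an entry falling between two values adjacent
  among the earlier ones lies halfway. The condition is symmetric under negation of
  \<open>F\<close>, so left continuity follows from right continuity.\<close>

locale midpoint_enum =
  fixes F :: "nat \<Rightarrow> real"
  assumes midpoint: "\<lbrakk>m < n; j < n; F m < F n; F n < F j; \<And>i. i < n \<Longrightarrow> \<not> (F m < F i \<and> F i < F j)\<rbrakk>
      \<Longrightarrow> F n = (F m + F j) / 2"
begin

text \<open>By density the gap above \<open>F m\<close> is entered again and again, and the first
  entry into it halves it. After \<open>k\<close> halvings the gap has shrunk by the factor
  \<open>2 ^ k\<close>.\<close>

lemma right_continuous:
  assumes j0: "F m < F j0" and dense: "\<And>j. F m < F j \<Longrightarrow> \<exists>k. F m < F k \<and> F k < F j"
    and r: "F m < r"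
  shows "\<exists>k. F m < F k \<and> F k < r"
proof -
  have *: "\<exists>j. F m < F j \<and> F j - F m \<le> (F j0 - F m) / 2 ^ k" for k
  proof (induction k)
    case 0
    then show ?case using j0 by auto
  next
    case (Suc k)
    then obtain j where j: "F m < F j" "F j - F m \<le> (F j0 - F m) / 2 ^ k" by blast
    \<comment> \<open>All indices up to \<open>max m j\<close> are considered, so that the first
      index \<open>n\<close> with a value strictly between \<open>F m\<close> and the minimum
      \<open>F j'\<close> comes after both \<open>m\<close> and \<open>j'\<close>, as
      \<open>midpoint\<close> requires.\<close>
    define S where "S = {i. i \<le> max m j \<and> F m < F i}"
    have S: "finite S" "j \<in> S" using j by (auto simp: S_def)
    then obtain j' where j': "j' \<in> S" "\<And>i. i \<in> S \<Longrightarrow> F j' \<le> F i"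
      using ex_min_if_finite[of "F ` S"] by (force simp: not_less)
    have ex: "\<exists>n. F m < F n \<and> F n < F j'" using dense j' by (auto simp: S_def)
    define n where "n = (LEAST n. F m < F n \<and> F n < F j')"
    have n: "F m < F n" "F n < F j'" using LeastI_ex[OF ex] unfolding n_def by auto
    have least: "\<not> (F m < F i \<and> F i < F j')" if "i < n" for i
      using not_less_Least that unfolding n_def by blast
    have "n > max m j" using n j'(2)[of n] by (force simp: S_def)
    then have "F n = (F m + F j') / 2"
      using n least j' by (intro midpoint) (auto simp: S_def)
    then have "F n - F m \<le> (F j - F m) / 2" using j'(2)[OF S(2)] by (simp add: field_simps)
    also have "\<dots> \<le> (F j0 - F m) / 2 ^ Suc k" using j(2) by (simp add: divide_simps)
    finally show ?case using n by blast
  qed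
  obtain k where "(F j0 - F m) / (r - F m) < 2 ^ k" using real_arch_pow[of 2] by auto
  then have "(F j0 - F m) / 2 ^ k < r - F m" using r by (simp add: field_simps)
  then show ?thesis using *[of k] by force
qed

lemma dual: "midpoint_enum (\<lambda>i. - F i)"
proof
  show "- F n = (- F m + - F j) / 2" if "m < n" "j < n" "- F m < - F n" "- F n < - F j"
    "\<And>i. i < n \<Longrightarrow> \<not> (- F m < - F i \<and> - F i < - F j)" for m n j
    using midpoint[of j n m] that by force
qed

end

text \<open>Placing each new element at the midpoint of its current neighbours makes the embedding
  continuous at every point where the order is dense, because the gap next to that point is halved
  infinitely often. Equivalent elements get the same value, as both neighbours then coincide.\<close>

fun midpoint_seq :: "('a \<Rightarrow> 'a \<Rightarrow> bool) \<Rightarrow> (nat \<Rightarrow> 'a) \<Rightarrow> nat \<Rightarrow> real" where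
  "midpoint_seq le e n = (if n = 0 then 0 else if n = 1 then 1 else
     (Max (midpoint_seq le e ` {i. i < n \<and> le (e i) (e n)}) +
      Min (midpoint_seq le e ` {i. i < n \<and> le (e n) (e i)})) / 2)"

declare midpoint_seq.simps[simp del]

context
  fixes le :: "'a \<Rightarrow> 'a \<Rightarrow> bool" and e :: "nat \<Rightarrow> 'a"
  assumes total: "\<And>x y. le x y \<or> le y x"
    and trans: "\<And>x y z. le x y \<Longrightarrow> le y z \<Longrightarrow> le x z"
    and bot: "\<And>x. le (e 0) x" and top: "\<And>x. le x (e 1)" and nontriv: "\<not> le (e 1) (e 0)"
begin

abbreviation "mseq \<equiv> midpoint_seq le e"
abbreviation "mlower n \<equiv> mseq ` {i. i < n \<and> le (e i) (e n)}"
abbreviation "mupper n \<equiv> mseq ` {i. i < n \<and> le (e n) (e i)}"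

lemma mseq_rec: "2 \<le> n \<Longrightarrow> mseq n = (Max (mlower n) + Min (mupper n)) / 2"
  by (subst midpoint_seq.simps) auto

lemma mlower_mupper:
  assumes "2 \<le> n"
  shows "finite (mlower n)" "mlower n \<noteq> {}" "finite (mupper n)" "mupper n \<noteq> {}"
proof -
  have "0 \<in> {i. i < n \<and> le (e i) (e n)}" "1 \<in> {i. i < n \<and> le (e n) (e i)}"
    using bot top assms by auto
  then show "mlower n \<noteq> {}" "mupper n \<noteq> {}" by blast+
qed auto

text \<open>The new value is the midpoint of the greatest earlier value below and the least earlier
  value above. If an earlier value on one side of it belonged to an element on the other side, the
  two neighbours would have to coincide, and transitivity through a neighbour gives a
  contradiction.\<close>

lemma mseq_le_iff_below: "i < n \<Longrightarrow> j < n \<Longrightarrow> mseq i \<le> mseq j \<longleftrightarrow> le (e i) (e j)"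
proof (induction n arbitrary: i j)
  case (Suc n)
  have refl: "le x x" for x using total by blast
  have IH: "mseq i \<le> mseq j \<longleftrightarrow> le (e i) (e j)" if "i < n" "j < n" for i j
    using Suc.IH that by blast
  consider "n = 0" | "n = 1" | "2 \<le> n" by linarith
  then show ?case
  proof cases
    case 1
    then show ?thesis using Suc.prems refl by auto
  next
    case 2
    then have "i = 0 \<or> i = 1" "j = 0 \<or> j = 1" using Suc.prems by auto
    moreover have "mseq 0 = 0" "mseq 1 = 1" by (subst midpoint_seq.simps, simp)+
    ultimately show ?thesis using refl bot nontriv by auto
  next
    case 3
    note lu = mlower_mupper[OF 3]
    obtain k where k: "k < n" "le (e k) (e n)" "Max (mlower n) = mseq k" using Max_in[OF lu(1,2)] by auto
    obtain l where l: "l < n" "le (e n) (e l)" "Min (mupper n) = mseq l" using Min_in[OF lu(3,4)] by auto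
    have Fn: "mseq n = (mseq k + mseq l) / 2" using mseq_rec[OF 3] k l by simp
    have kl: "mseq k \<le> mseq l" using IH k l trans by blast
    have low: "mseq i \<le> mseq k" if "i < n" "le (e i) (e n)" for i
      using Max_ge[OF lu(1), of "mseq i"] that k by auto
    have up: "mseq l \<le> mseq i" if "i < n" "le (e n) (e i)" for i
      using Min_le[OF lu(3), of "mseq i"] that l by auto
    have a: "mseq i \<le> mseq n \<longleftrightarrow> le (e i) (e n)" and b: "mseq n \<le> mseq i \<longleftrightarrow> le (e n) (e i)" if i: "i < n" for i
    proof -
      show "mseq i \<le> mseq n \<longleftrightarrow> le (e i) (e n)"
      proof
        assume le: "mseq i \<le> mseq n"
        show "le (e i) (e n)"
        proof (rule ccontr)
          assume not: "\<not> le (e i) (e n)"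
          then have "mseq l \<le> mseq i" using up i total by blast
          then have "mseq i \<le> mseq k" using le kl Fn by simp
          then show False using IH[OF i k(1)] k(2) trans not by blast
        qed
      next
        assume "le (e i) (e n)"
        then show "mseq i \<le> mseq n" using low[OF i] kl Fn by simp
      qed
      show "mseq n \<le> mseq i \<longleftrightarrow> le (e n) (e i)"
      proof
        assume le: "mseq n \<le> mseq i"
        show "le (e n) (e i)"
        proof (rule ccontr)
          assume not: "\<not> le (e n) (e i)"
          then have "mseq i \<le> mseq k" using low i total by blast
          then have "mseq l \<le> mseq i" using le kl Fn by simp
          then show False using IH[OF l(1) i] l(2) trans not by blast
        qed
      next
        assume "le (e n) (e i)"
        then show "mseq n \<le> mseq i" using up[OF i] kl Fn by simp
      qed
    qed
    show ?thesis using Suc.prems a b IH refl by (auto simp: less_Suc_eq)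
  qed
qed simp

lemma mseq_le_iff: "mseq i \<le> mseq j \<longleftrightarrow> le (e i) (e j)"
  using mseq_le_iff_below[of i "Suc (max i j)" j] by simp

text \<open>If no earlier value lies strictly between those at \<open>m\<close> and
  \<open>j\<close>, these two are exactly the maximum and the minimum used in the recursion.\<close>

lemma midpoint_enum_mseq: "midpoint_enum mseq"
proof
  fix m n j assume *: "m < n" "j < n" "mseq m < mseq n" "mseq n < mseq j"
    and btw: "\<And>i. i < n \<Longrightarrow> \<not> (mseq m < mseq i \<and> mseq i < mseq j)"
  have "n \<noteq> 0" "n \<noteq> 1" using * by auto
  then have n: "2 \<le> n" by simp
  have "mseq i \<le> mseq m" if "i < n" "le (e i) (e n)" for i
    using that btw[OF that(1)] mseq_le_iff[of i n] * by force
  moreover have "mseq j \<le> mseq i" if "i < n" "le (e n) (e i)" for i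
    using that btw[OF that(1)] mseq_le_iff[of n i] * by force
  moreover have "mseq m \<in> mlower n" "mseq j \<in> mupper n" using * mseq_le_iff by (auto intro: less_imp_le)
  ultimately have "Max (mlower n) = mseq m" "Min (mupper n) = mseq j"
    using mlower_mupper[OF n] by (auto intro!: Max_eqI Min_eqI)
  then show "mseq n = (mseq m + mseq j) / 2" using mseq_rec[OF n] by simp
qed

end

text \<open>The last two conjuncts are continuity from the right and from the left: wherever the
  order is dense next to \<open>x\<close>, the image has no gap next to \<open>f x\<close>. This is
  what later preserves infima and suprema.\<close>

theorem countable_preorder_embedding:
  fixes le :: "'a :: countable \<Rightarrow> 'a \<Rightarrow> bool"
  assumes total: "\<And>x y. le x y \<or> le y x"
    and trans: "transp le"
    and bot: "\<And>x. le z x" and top: "\<And>x. le x t" and nontriv: "\<not> le t z"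
  shows "\<exists>f :: 'a \<Rightarrow> real. (\<forall>x y. f x \<le> f y \<longleftrightarrow> le x y) \<and> f z = 0 \<and> f t = 1
    \<and> (\<forall>x r. f x < f t \<longrightarrow> (\<forall>y. f x < f y \<longrightarrow> (\<exists>y'. f x < f y' \<and> f y' < f y)) \<longrightarrow> f x < r
         \<longrightarrow> (\<exists>y. f x < f y \<and> f y < r))
    \<and> (\<forall>x r. f z < f x \<longrightarrow> (\<forall>y. f y < f x \<longrightarrow> (\<exists>y'. f y < f y' \<and> f y' < f x)) \<longrightarrow> r < f x
         \<longrightarrow> (\<exists>y. f y < f x \<and> r < f y))"
proof -
  \<comment> \<open>Indices 0 and 1 are reserved for the endpoints, and the enumeration of the type
    is shifted by 2. The endpoints therefore occur twice, but equivalent elements receive equal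
    values.\<close>
  define e :: "nat \<Rightarrow> 'a" where
    "e n = (if n = 0 then z else if n = 1 then t else from_nat (n - 2))" for n
  define ix where "ix x = to_nat x + 2" for x :: 'a
  have e_ix[simp]: "e (ix x) = x" for x by (simp add: e_def ix_def)
  define F where "F = midpoint_seq le e"
  have e01: "e 0 = z" "e 1 = t" by (auto simp: e_def)
  have iff: "F i \<le> F j \<longleftrightarrow> le (e i) (e j)" for i j
    unfolding F_def by (rule mseq_le_iff) (use assms e01 in \<open>auto dest: transpD\<close>)
  interpret midpoint_enum F
    unfolding F_def by (rule midpoint_enum_mseq) (use assms e01 in \<open>auto dest: transpD\<close>)
  interpret d: midpoint_enum "\<lambda>i. - F i" by (rule dual)
  define f where "f x = F (ix x)" for x
  have F_f: "F i = f (e i)" for i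
    unfolding f_def using iff[of i "ix (e i)"] iff[of "ix (e i)" i] total by (metis e_ix order_antisym)
  show ?thesis
  proof (rule exI[of _ f], intro conjI allI impI)
    show "f x \<le> f y \<longleftrightarrow> le x y" for x y by (simp add: f_def iff)
    have "F 0 = 0" "F 1 = 1" unfolding F_def by (subst midpoint_seq.simps, simp)+
    then show "f z = 0" "f t = 1" using F_f e01 by metis+
  next
    fix x r assume *: "f x < f t" "\<forall>y. f x < f y \<longrightarrow> (\<exists>y'. f x < f y' \<and> f y' < f y)" "f x < r"
    have "\<exists>k. F (ix x) < F k \<and> F k < r"
      by (rule right_continuous[of _ "ix t"]) (use * in \<open>auto simp: F_f, metis e_ix\<close>)
    then show "\<exists>y. f x < f y \<and> f y < r" by (auto simp: F_f)
  next
    fix x r assume *: "f z < f x" "\<forall>y. f y < f x \<longrightarrow> (\<exists>y'. f y < f y' \<and> f y' < f x)" "r < f x"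
    have "\<exists>k. - F (ix x) < - F k \<and> - F k < - r"
      by (rule d.right_continuous[of _ "ix z"]) (use * in \<open>auto simp: F_f, metis e_ix\<close>)
    then show "\<exists>y. f y < f x \<and> r < f y" by (auto simp: F_f)
  qed
qed

section \<open>Propositional completeness and rescaling\<close>

instance fm :: countable
  by countable_datatype

text \<open>Common ground of \<open>KG\<close> and of the extension of \<open>KG_dia\<close> to the
  full language, so that propositional completeness is proved once for both.\<close>

locale goedel_logic =
  fixes L :: "fm \<Rightarrow> bool"
  assumes goedel: "goedel_axiom \<phi> \<Longrightarrow> L \<phi>"
    and MP: "L (\<phi> \<^bold>\<rightarrow> \<psi>) \<Longrightarrow> L \<phi> \<Longrightarrow> L \<psi>"

definition logic_hom :: "(fm \<Rightarrow> bool) \<Rightarrow> (fm \<Rightarrow> real) \<Rightarrow> bool" where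
  "logic_hom L h \<longleftrightarrow> goedel_hom h \<and> (\<forall>\<theta>. L \<theta> \<longrightarrow> h \<theta> = 1)"

lemma goedel_hom_simps:
  assumes "goedel_hom h"
  shows "h \<^bold>\<bottom> = 0" "h (\<phi> \<^bold>\<and> \<psi>) = min (h \<phi>) (h \<psi>)" "h (\<phi> \<^bold>\<or> \<psi>) = max (h \<phi>) (h \<psi>)"
    "h (\<phi> \<^bold>\<rightarrow> \<psi>) = gimp (h \<phi>) (h \<psi>)" "0 \<le> h \<phi>" "h \<phi> \<le> 1"
  using assms unfolding goedel_hom_def by (auto simp: image_subset_iff)

lemma logic_hom_Imp:
  assumes "logic_hom L h" "L (\<phi> \<^bold>\<rightarrow> \<psi>)"
  shows "h \<phi> \<le> h \<psi>"
proof -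
  have g: "goedel_hom h" and "h (\<phi> \<^bold>\<rightarrow> \<psi>) = 1" using assms by (auto simp: logic_hom_def)
  then show ?thesis by (simp add: goedel_hom_simps[OF g] gimp_eq_1_iff)
qed

section \<open>Derivability from premises and propositional strong completeness\<close>

lemma derives_mono: "derives L S \<phi> \<Longrightarrow> S \<subseteq> T \<Longrightarrow> derives L T \<phi>"
  by (induction rule: derives.induct) (auto intro: derives.intros)

lemma derives_finite_subset: "derives L T \<phi> \<Longrightarrow> \<exists>S\<subseteq>T. finite S \<and> derives L S \<phi>"
proof (induction rule: derives.induct)
  case (derives_premise \<phi>)
  then show ?case by (intro exI[of _ "{\<phi>}"]) (auto intro: derives.intros)
next
  case (derives_theorem \<phi>)
  then show ?case by (intro exI[of _ "{}"]) (auto intro: derives.intros)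
next
  case (derives_MP \<phi> \<psi>)
  then obtain S S' where "S \<subseteq> T" "finite S" "derives L S (\<phi> \<^bold>\<rightarrow> \<psi>)"
    "S' \<subseteq> T" "finite S'" "derives L S' \<phi>" by blast
  then show ?case
    by (intro exI[of _ "S \<union> S'"]) (auto intro: derives.derives_MP derives_mono)
qed

context goedel_logic
begin

lemma derives_empty: "derives L {} \<phi> \<Longrightarrow> L \<phi>"
  by (induction rule: derives.induct) (auto intro: MP)

lemma derives_axiom: "goedel_axiom \<phi> \<Longrightarrow> derives L T \<phi>"
  by (intro derives_theorem goedel)

lemma derives_refl: "derives L T (\<phi> \<^bold>\<rightarrow> \<phi>)"
  using derives_MP[OF derives_MP[OF derives_axiom derives_axiom] derives_axiom, OF
      goedel_axiom.intros(2)[of \<phi> "\<phi> \<^bold>\<rightarrow> \<phi>" \<phi>] goedel_axiom.intros(1) goedel_axiom.intros(1)] .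

lemma derives_weaken: "derives L T \<psi> \<Longrightarrow> derives L T (\<phi> \<^bold>\<rightarrow> \<psi>)"
  by (meson derives_MP derives_axiom goedel_axiom.intros(1))

lemma derives_MP_under:
  "derives L T (\<phi> \<^bold>\<rightarrow> \<psi> \<^bold>\<rightarrow> \<chi>) \<Longrightarrow> derives L T (\<phi> \<^bold>\<rightarrow> \<psi>) \<Longrightarrow> derives L T (\<phi> \<^bold>\<rightarrow> \<chi>)"
  by (meson derives_MP derives_axiom goedel_axiom.intros(2))

lemma derives_trans:
  "derives L T (\<phi> \<^bold>\<rightarrow> \<psi>) \<Longrightarrow> derives L T (\<psi> \<^bold>\<rightarrow> \<chi>) \<Longrightarrow> derives L T (\<phi> \<^bold>\<rightarrow> \<chi>)"
  by (meson derives_MP_under derives_weaken)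

text \<open>Only modus ponens acts on premises, the modal rules being confined to theorems; hence
  the usual argument from the first two axioms applies.\<close>

lemma deduction:
  assumes "derives L (insert \<alpha> T) \<beta>"
  shows "derives L T (\<alpha> \<^bold>\<rightarrow> \<beta>)"
  using assms
proof induction
  case (derives_premise \<phi>)
  then show ?case using derives_refl derives_weaken derives.derives_premise by blast
next
  case (derives_theorem \<phi>)
  then show ?case by (intro derives_weaken derives.derives_theorem)
next
  case (derives_MP \<phi> \<psi>)
  then show ?case by (blast intro: derives_MP_under)
qed

lemma derives_cases_Or:
  assumes "derives L T (\<alpha> \<^bold>\<or> \<beta>)" "derives L (insert \<alpha> T) \<phi>" "derives L (insert \<beta> T) \<phi>"
  shows "derives L T \<phi>"
  using assms deduction by (meson derives_MP derives_axiom goedel_axiom.intros(8))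

text \<open>A maximal extension \<open>T\<close> of \<Gamma> not deriving \<phi> is prime, so
  prelinearity makes provable implication over \<open>T\<close> a total preorder on the countable
  set of formulas. Its embedding into the unit interval is a homomorphism with value 1 exactly at
  the formulas derivable from \<open>T\<close>.\<close>

theorem hom_separation:
  assumes "\<not> derives L \<Gamma> \<phi>"
  obtains h where "logic_hom L h" "\<forall>\<gamma>\<in>\<Gamma>. h \<gamma> = 1" "h \<phi> < 1"
proof -
  define A where "A = {T. \<Gamma> \<subseteq> T \<and> \<not> derives L T \<phi>}"
  have "A \<noteq> {}" using assms by (auto simp: A_def)
  moreover have "\<Union>C \<in> A" if C: "C \<noteq> {}" "subset.chain A C" for C
  proof -
    have CA: "C \<subseteq> A" using C(2) by (auto simp: subset.chain_def)
    have "\<not> derives L (\<Union>C) \<phi>"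
    proof
      assume "derives L (\<Union>C) \<phi>"
      from derives_finite_subset[OF this]
      obtain S where S: "S \<subseteq> \<Union>C" "finite S" "derives L S \<phi>" by auto
      then obtain B where "B \<in> C" "S \<subseteq> B"
        using finite_subset_Union_chain[OF S(2,1) C] by blast
      then have "derives L B \<phi>" "\<not> derives L B \<phi>"
        using derives_mono[OF S(3)] CA by (auto simp: A_def)
      then show False by blast
    qed
    then show ?thesis using CA C(1) by (auto simp: A_def)
  qed
  ultimately obtain T where T: "T \<in> A" and max: "\<And>X. X \<in> A \<Longrightarrow> T \<subseteq> X \<Longrightarrow> X = T"
    using subset_Zorn_nonempty[of A] by metis
  have \<Gamma>T: "\<Gamma> \<subseteq> T" and not: "\<not> derives L T \<phi>" using T by (auto simp: A_def)
  let ?d = "derives L T"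
  have ins: "derives L (insert \<alpha> T) \<phi>" if "\<not> ?d \<alpha>" for \<alpha>
  proof (rule ccontr)
    assume "\<not> derives L (insert \<alpha> T) \<phi>"
    then have "insert \<alpha> T = T" using \<Gamma>T by (intro max) (auto simp: A_def)
    then show False using that derives_premise[of \<alpha> T L] by blast
  qed
  have prime: "?d \<alpha> \<or> ?d \<beta>" if "?d (\<alpha> \<^bold>\<or> \<beta>)" for \<alpha> \<beta>
    using derives_cases_Or[OF that] ins not by blast
  define le where "le \<alpha> \<beta> = ?d (\<alpha> \<^bold>\<rightarrow> \<beta>)" for \<alpha> \<beta>
  have total: "le \<alpha> \<beta> \<or> le \<beta> \<alpha>" for \<alpha> \<beta>
    unfolding le_def by (rule prime, rule derives_axiom, rule goedel_axiom.intros)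
  have trans: "transp le"
    unfolding le_def by (rule transpI) (rule derives_trans)
  let ?T = "\<^bold>\<not> \<^bold>\<bottom>"
  have le_top: "le ?T \<alpha> \<longleftrightarrow> ?d \<alpha>" for \<alpha>
    unfolding le_def using derives_weaken derives_MP derives_refl by blast
  have bot: "le \<^bold>\<bottom> \<alpha>" for \<alpha>
    unfolding le_def by (rule derives_axiom, rule goedel_axiom.intros)
  have nontriv: "\<not> le ?T \<^bold>\<bottom>"
    using not derives_MP[OF bot[unfolded le_def]] unfolding le_top by blast
  have top: "le \<alpha> ?T" for \<alpha>
    unfolding le_def by (intro derives_weaken derives_refl)
  obtain f :: "fm \<Rightarrow> real" where f: "\<And>\<alpha> \<beta>. f \<alpha> \<le> f \<beta> \<longleftrightarrow> le \<alpha> \<beta>" "f \<^bold>\<bottom> = 0" "f ?T = 1"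
    using countable_preorder_embedding[of le "\<^bold>\<bottom>" ?T, OF total trans bot top nontriv] by blast
  have f01: "0 \<le> f \<alpha>" "f \<alpha> \<le> 1" for \<alpha>
    using f(1)[of "\<^bold>\<bottom>" \<alpha>] f(1)[of \<alpha> ?T] bot top f(2,3) by auto
  have f1: "f \<alpha> = 1 \<longleftrightarrow> ?d \<alpha>" for \<alpha>
    using f(1)[of ?T \<alpha>] f(3) f01[of \<alpha>] le_top by auto
  have And: "f (\<alpha> \<^bold>\<and> \<beta>) = min (f \<alpha>) (f \<beta>)" for \<alpha> \<beta>
  proof -
    have *: "f (\<alpha> \<^bold>\<and> \<beta>) \<le> f \<alpha>" "f (\<alpha> \<^bold>\<and> \<beta>) \<le> f \<beta>"
      unfolding f le_def by (rule derives_axiom, rule goedel_axiom.intros)+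
    have "f \<gamma> \<le> f (\<alpha> \<^bold>\<and> \<beta>)" if "f \<gamma> \<le> f \<alpha>" "f \<gamma> \<le> f \<beta>" for \<gamma>
      using that unfolding f le_def
      by (meson derives_MP_under derives_axiom derives_weaken goedel_axiom.intros(5))
    from this[of \<alpha>] this[of \<beta>] * show ?thesis by (auto simp: min_def)
  qed
  have Or: "f (\<alpha> \<^bold>\<or> \<beta>) = max (f \<alpha>) (f \<beta>)" for \<alpha> \<beta>
  proof -
    have *: "f \<alpha> \<le> f (\<alpha> \<^bold>\<or> \<beta>)" "f \<beta> \<le> f (\<alpha> \<^bold>\<or> \<beta>)"
      unfolding f le_def by (rule derives_axiom, rule goedel_axiom.intros)+
    have "f (\<alpha> \<^bold>\<or> \<beta>) \<le> f \<gamma>" if "f \<alpha> \<le> f \<gamma>" "f \<beta> \<le> f \<gamma>" for \<gamma>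
      using that unfolding f le_def by (meson derives_MP derives_axiom goedel_axiom.intros(8))
    from this[of \<alpha>] this[of \<beta>] * show ?thesis by (auto simp: max_def)
  qed
  have Imp: "f (\<alpha> \<^bold>\<rightarrow> \<beta>) = gimp (f \<alpha>) (f \<beta>)" for \<alpha> \<beta>
  proof (cases "le \<alpha> \<beta>")
    case True
    then show ?thesis using f(1)[of \<alpha> \<beta>] f1[of "\<alpha> \<^bold>\<rightarrow> \<beta>"] by (simp add: le_def gimp_def)
  next
    case False
    \<comment> \<open>By contraction \<alpha> below \<alpha> \<rightarrow> \<beta> would give
      \<alpha> below \<beta>. By totality the implication is then below \<alpha>, and modus ponens
      under the implication places it below \<beta>.\<close>
    then have "\<not> le \<alpha> (\<alpha> \<^bold>\<rightarrow> \<beta>)" unfolding le_def using derives_MP_under derives_refl by blast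
    then have "?d ((\<alpha> \<^bold>\<rightarrow> \<beta>) \<^bold>\<rightarrow> \<alpha>)" using total unfolding le_def by blast
    then have "le (\<alpha> \<^bold>\<rightarrow> \<beta>) \<beta>" unfolding le_def using derives_MP_under derives_refl by blast
    moreover have "le \<beta> (\<alpha> \<^bold>\<rightarrow> \<beta>)"
      unfolding le_def by (rule derives_axiom, rule goedel_axiom.intros)
    ultimately show ?thesis using False f(1) by (auto simp: gimp_def intro: order_antisym)
  qed
  have "logic_hom L f"
    using f01 f(2) f1 And Or Imp derives_theorem by (auto simp: logic_hom_def goedel_hom_def)
  then show ?thesis
  proof (rule that)
    show "\<forall>\<gamma>\<in>\<Gamma>. f \<gamma> = 1" using \<Gamma>T f1 derives_premise by blast
    show "f \<phi> < 1" using f1[of \<phi>] f01[of \<phi>] not by auto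
  qed
qed

corollary derivesI:
  "(\<And>h. logic_hom L h \<Longrightarrow> (\<And>\<gamma>. \<gamma> \<in> \<Gamma> \<Longrightarrow> h \<gamma> = 1) \<Longrightarrow> h \<phi> = 1) \<Longrightarrow> derives L \<Gamma> \<phi>"
  using hom_separation by (metis less_irrefl)

corollary theoremI: "(\<And>h. logic_hom L h \<Longrightarrow> h \<phi> = 1) \<Longrightarrow> L \<phi>"
  using derivesI[of "{}"] derives_empty by blast

end

text \<open>With \<open>A t\<close> the largest lower bound imposed at or below \<open>t\<close>, and \<open>B t\<close> the smallest upper
  bound imposed at or above \<open>t\<close>, the convex combination \<open>(1 - t) A t + t B t\<close> is strictly
  increasing, although \<open>A\<close> and \<open>B\<close> are only step functions.\<close>

lemma strict_mono_interpolation: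
  fixes P Q :: "(real \<times> real) set"
  assumes fin: "finite P" "finite Q"
    and 0: "(0, 0) \<in> P" "(0, 0) \<in> Q" and 1: "(1, 1) \<in> P" "(1, 1) \<in> Q"
    and le: "\<And>x a y b. (x, a) \<in> P \<Longrightarrow> (y, b) \<in> Q \<Longrightarrow> x \<le> y \<Longrightarrow> a \<le> b"
    and less: "\<And>x a y b. (x, a) \<in> P \<Longrightarrow> (y, b) \<in> Q \<Longrightarrow> x < y \<Longrightarrow> a < b"
  shows "\<exists>s :: real \<Rightarrow> real. strict_mono_on {0..1} s \<and> s 0 = 0 \<and> s 1 = 1 \<and>
    (\<forall>(x, a)\<in>P. x \<in> {0..1} \<longrightarrow> a \<le> s x) \<and> (\<forall>(y, b)\<in>Q. y \<in> {0..1} \<longrightarrow> s y \<le> b)"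
proof -
  define PA where "PA t = snd ` {p \<in> P. fst p \<le> t}" for t
  define QB where "QB t = snd ` {q \<in> Q. t \<le> fst q}" for t
  define A where "A t = Max (PA t)" for t
  define B where "B t = Min (QB t)" for t
  define s where "s t = (1 - t) * A t + t * B t" for t
  have PA: "finite (PA t)" "0 \<le> t \<Longrightarrow> 0 \<in> PA t" for t
    using fin(1) 0(1) unfolding PA_def by (auto simp: image_iff intro!: bexI[of _ "(0,0)"])
  have QB: "finite (QB t)" "t \<le> 1 \<Longrightarrow> 1 \<in> QB t" for t
    using fin(2) 1(2) unfolding QB_def by (auto simp: image_iff intro!: bexI[of _ "(1,1)"])
  have A_in: "A t \<in> PA t" if "0 \<le> t" for t
    unfolding A_def using PA that by (intro Max_in) auto
  have B_in: "B t \<in> QB t" if "t \<le> 1" for t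
    unfolding B_def using QB that by (intro Min_in) auto
  have A_ge: "a \<le> A t" if "(x, a) \<in> P" "x \<le> t" for x a t
    unfolding A_def using that PA by (intro Max_ge) (force simp: PA_def)+
  have B_le: "B t \<le> b" if "(y, b) \<in> Q" "t \<le> y" for y b t
    unfolding B_def using that QB by (intro Min_le) (force simp: QB_def)+
  have A_mono: "A t \<le> A t'" if "t \<le> t'" "0 \<le> t" for t t'
    using A_in[of t] A_ge that unfolding PA_def by force
  have B_mono: "B t \<le> B t'" if "t \<le> t'" "t' \<le> 1" for t t'
    using B_in[of t'] B_le that unfolding QB_def by force
  have AB: "A t \<le> B t" if "t \<in> {0..1}" for t
    using A_in[of t] B_in[of t] le that unfolding PA_def QB_def by force
  have AB_less: "A t < B t'" if "t < t'" "0 \<le> t" "t' \<le> 1" for t t'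
    using A_in[of t] B_in[of t'] less that unfolding PA_def QB_def by force
  have bounds: "A t \<le> s t" "s t \<le> B t" if "t \<in> {0..1}" for t
  proof -
    have "s t = A t + t * (B t - A t)" "s t = B t - (1 - t) * (B t - A t)"
      by (auto simp: s_def algebra_simps)
    moreover have "0 \<le> t * (B t - A t)" "0 \<le> (1 - t) * (B t - A t)"
      using AB[OF that] that by auto
    ultimately show "A t \<le> s t" "s t \<le> B t" by auto
  qed
  show ?thesis
  proof (intro exI conjI)
    show "strict_mono_on {0..1} s"
    proof (rule strict_mono_onI)
      fix t t' :: real assume t: "t \<in> {0..1}" "t' \<in> {0..1}" "t < t'"
      have "A t \<le> A t'" "B t \<le> B t'" "A t < B t'"
        using t A_mono B_mono AB_less by auto
      have "(1 - t') * A t \<le> (1 - t') * A t'"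
        using t \<open>A t \<le> A t'\<close> by (intro mult_left_mono) auto
      then have le1: "(1 - t') * A t + t' * B t' \<le> s t'" by (simp add: s_def)
      show "s t < s t'"
      \<comment> \<open>If \<open>A t < B t\<close>, moving weight from \<open>A\<close> to
        \<open>B\<close> is a strict gain. Otherwise \<open>A t = B t\<close>, and the strict gain
        comes from \<open>A t < B t'\<close> with the positive weight \<open>t'\<close>.\<close>
      proof (cases "A t < B t")
        case True
        have "t' * B t \<le> t' * B t'" using t \<open>B t \<le> B t'\<close> by (intro mult_left_mono) auto
        moreover have "0 < (t' - t) * (B t - A t)" using True t by auto
        ultimately show ?thesis using le1 unfolding s_def[of t] by (simp add: algebra_simps)
      next
        case False
        then have "s t = A t" using AB[OF t(1)] bounds[OF t(1)] by simp
        moreover have "0 < t' * (B t' - A t)" using t \<open>A t < B t'\<close> by auto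
        ultimately show ?thesis using le1 by (simp add: algebra_simps)
      qed
    qed
    show "\<forall>(x, a)\<in>P. x \<in> {0..1} \<longrightarrow> a \<le> s x"
      using bounds(1) A_ge order_trans by blast
    show "\<forall>(y, b)\<in>Q. y \<in> {0..1} \<longrightarrow> s y \<le> b"
      using bounds(2) B_le order_trans by blast
    show "s 0 = 0" using bounds[of 0] A_ge[OF 0(1), of 0] B_le[OF 0(2), of 0] by simp
    show "s 1 = 1" using bounds[of 1] A_ge[OF 1(1), of 1] B_le[OF 1(2), of 1] by simp
  qed
qed

text \<open>The Goedel operations depend only on the order and on the endpoints 0 and 1, all of
  which \<open>s\<close> preserves.\<close>

lemma logic_hom_rescale:
  assumes h: "logic_hom L h" and s: "strict_mono_on {0..1} s" "s 0 = 0" "s 1 = 1"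
  shows "logic_hom L (s \<circ> h)"
proof -
  have g: "goedel_hom h" using h by (simp add: logic_hom_def)
  have u: "h \<phi> \<in> {0..1}" for \<phi> using goedel_hom_simps(5,6)[OF g] by simp
  have less: "s x < s y \<longleftrightarrow> x < y" if "x \<in> {0..1}" "y \<in> {0..1}" for x y
    using strict_mono_onD[OF s(1)] that by (metis less_irrefl linorder_neqE order_less_trans)
  then have le: "s (h \<phi>) \<le> s (h \<psi>) \<longleftrightarrow> h \<phi> \<le> h \<psi>" for \<phi> \<psi>
    using u by (meson not_less)
  have "0 \<le> s (h \<phi>)" "s (h \<phi>) \<le> 1" for \<phi>
    using less[of "h \<phi>" 0] less[of 1 "h \<phi>"] u[of \<phi>] s(2,3) by auto
  then show ?thesis
    using h s le by (auto simp: logic_hom_def goedel_hom_def gimp_def min_def max_def)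
qed

text \<open>A pair (\<psi>, a) in \<open>P\<close> demands \<open>a \<le> g \<psi>\<close>, a pair
  (\<chi>, b) in \<open>Q\<close> demands \<open>g \<chi> \<le> b\<close>. The condition compares
  demands pairwise and leaves only the order of values of \<open>u\<close> to be checked, so that a
  rescaling of \<open>u\<close> can meet them all.\<close>

definition order_compatible :: "(fm \<times> real) set \<Rightarrow> (fm \<times> real) set \<Rightarrow> (fm \<Rightarrow> real) \<Rightarrow> bool" where
  "order_compatible P Q u \<longleftrightarrow> (\<forall>(\<psi>, a)\<in>P. \<forall>(\<chi>, b)\<in>Q. (a = b \<longrightarrow> u \<chi> \<le> u \<psi>) \<and> (b < a \<longrightarrow> u \<chi> < u \<psi>))"

text \<open>Compatibility, read contrapositively, is the pair of monotonicity hypotheses of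
  \<open>strict_mono_interpolation\<close> for the bounds transported along \<open>u\<close>. The
  pairs for \<bottom> and \<not>\<bottom> become the fixed endpoints.\<close>

lemma logic_hom_interpolation:
  fixes P Q :: "(fm \<times> real) set"
  assumes u: "logic_hom L u" and fin: "finite P" "finite Q"
    and bot: "(\<^bold>\<bottom>, 0) \<in> P" "(\<^bold>\<bottom>, 0) \<in> Q" and top: "(\<^bold>\<not> \<^bold>\<bottom>, 1) \<in> P" "(\<^bold>\<not> \<^bold>\<bottom>, 1) \<in> Q"
    and oc: "order_compatible P Q u"
  shows "\<exists>g. logic_hom L g \<and> (\<forall>(\<psi>, a)\<in>P. a \<le> g \<psi>) \<and> (\<forall>(\<chi>, b)\<in>Q. g \<chi> \<le> b)"
proof -
  have eq: "u \<chi> \<le> u \<psi>" if "(\<psi>, a) \<in> P" "(\<chi>, a) \<in> Q" for \<psi> \<chi> a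
    using oc that unfolding order_compatible_def by blast
  have less: "u \<chi> < u \<psi>" if "(\<psi>, a) \<in> P" "(\<chi>, b) \<in> Q" "b < a" for \<psi> \<chi> a b
    using oc that unfolding order_compatible_def by blast
  have g: "goedel_hom u" using u by (simp add: logic_hom_def)
  note us = goedel_hom_simps[OF g]
  have u1: "u (\<^bold>\<not> \<^bold>\<bottom>) = 1" by (simp add: us gimp_def)
  let ?P = "map_prod u id ` P" and ?Q = "map_prod u id ` Q"
  have 01: "(0, 0) \<in> ?P" "(0, 0) \<in> ?Q" "(1, 1) \<in> ?P" "(1, 1) \<in> ?Q"
    using bot top u1 us(1) by (force simp: image_iff)+
  have le_: "a \<le> b" if "(x, a) \<in> ?P" "(y, b) \<in> ?Q" "x \<le> y" for x a y b
    using that less by fastforce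
  have less_: "a < b" if xy: "(x, a) \<in> ?P" "(y, b) \<in> ?Q" "x < y" for x a y b
  proof -
    obtain \<psi> \<chi> where "(\<psi>, a) \<in> P" "x = u \<psi>" "(\<chi>, b) \<in> Q" "y = u \<chi>" using xy by auto
    then show ?thesis using xy less[of \<psi> a \<chi> b] eq[of \<psi> a \<chi>] by (cases a b rule: linorder_cases) auto
  qed
  have "\<exists>s :: real \<Rightarrow> real. strict_mono_on {0..1} s \<and> s 0 = 0 \<and> s 1 = 1 \<and>
    (\<forall>(x, a)\<in>?P. x \<in> {0..1} \<longrightarrow> a \<le> s x) \<and> (\<forall>(y, b)\<in>?Q. y \<in> {0..1} \<longrightarrow> s y \<le> b)"
  proof (rule strict_mono_interpolation)
    show "finite ?P" "finite ?Q" using fin by auto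
  qed (fact 01 le_ less_)+
  then obtain s where s: "strict_mono_on {0..1} s" "s 0 = 0" "s 1 = 1"
    and sP: "\<forall>(x, a)\<in>?P. x \<in> {0..1} \<longrightarrow> a \<le> s x" and sQ: "\<forall>(y, b)\<in>?Q. y \<in> {0..1} \<longrightarrow> s y \<le> b"
    by blast
  have "a \<le> (s \<circ> u) \<psi>" if "(\<psi>, a) \<in> P" for \<psi> a
    using bspec[OF sP imageI[OF that]] us(5,6)[of \<psi>] by simp
  moreover have "(s \<circ> u) \<chi> \<le> b" if "(\<chi>, b) \<in> Q" for \<chi> b
    using bspec[OF sQ imageI[OF that]] us(5,6)[of \<chi>] by simp
  ultimately show ?thesis using logic_hom_rescale[OF u s] by blast
qed

section \<open>Successors in the canonical model\<close>

primrec Disj :: "fm list \<Rightarrow> fm" where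
  "Disj [] = \<^bold>\<bottom>"
| "Disj (\<phi> # \<phi>s) = \<phi> \<^bold>\<or> Disj \<phi>s"

primrec Conj :: "fm list \<Rightarrow> fm" where
  "Conj [] = \<^bold>\<not> \<^bold>\<bottom>"
| "Conj (\<phi> # \<phi>s) = \<phi> \<^bold>\<and> Conj \<phi>s"

lemma goedel_hom_Disj_ge: "goedel_hom h \<Longrightarrow> \<phi> \<in> set \<phi>s \<Longrightarrow> h \<phi> \<le> h (Disj \<phi>s)"
  by (induction \<phi>s) (auto simp: goedel_hom_simps le_max_iff_disj)

lemma goedel_hom_Conj_le: "goedel_hom h \<Longrightarrow> \<phi> \<in> set \<phi>s \<Longrightarrow> h (Conj \<phi>s) \<le> h \<phi>"
  by (induction \<phi>s) (auto simp: goedel_hom_simps min_le_iff_disj)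

definition canonical_rel :: "fm set \<Rightarrow> (fm \<Rightarrow> real) \<Rightarrow> (fm \<Rightarrow> real) \<Rightarrow> bool" where
  "canonical_rel \<Omega> h g \<longleftrightarrow> (\<forall>\<phi>. \<^bold>\<box> \<phi> \<in> \<Omega> \<longrightarrow> h (\<^bold>\<box> \<phi>) \<le> g \<phi>) \<and> (\<forall>\<phi>. \<^bold>\<diamond> \<phi> \<in> \<Omega> \<longrightarrow> g \<phi> \<le> h (\<^bold>\<diamond> \<phi>))"

text \<open>The demands on a successor of \<open>h\<close>. The two constant pairs, met by every
  homomorphism, fix the endpoints of the rescaling and make \<open>order_compatible\<close> compare
  the bounds with 0 and 1 too.\<close>

definition lower_bounds :: "fm set \<Rightarrow> (fm \<Rightarrow> real) \<Rightarrow> (fm \<times> real) set" where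
  "lower_bounds \<Omega> h = {(\<^bold>\<bottom>, 0), (\<^bold>\<not> \<^bold>\<bottom>, 1)} \<union> (\<lambda>\<psi>. (\<psi>, h (\<^bold>\<box> \<psi>))) ` (Box -` \<Omega>)"

definition upper_bounds :: "fm set \<Rightarrow> (fm \<Rightarrow> real) \<Rightarrow> (fm \<times> real) set" where
  "upper_bounds \<Omega> h = {(\<^bold>\<bottom>, 0), (\<^bold>\<not> \<^bold>\<bottom>, 1)} \<union> (\<lambda>\<psi>. (\<psi>, h (\<^bold>\<diamond> \<psi>))) ` (Dia -` \<Omega>)"

lemma finite_bounds: "finite \<Omega> \<Longrightarrow> finite (lower_bounds \<Omega> h)" "finite \<Omega> \<Longrightarrow> finite (upper_bounds \<Omega> h)"
  unfolding lower_bounds_def upper_bounds_def by (auto intro!: finite_vimageI simp: inj_def)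

text \<open>\<open>P\<close> and \<open>Q\<close> hold the additional demands on the successor at
  the formula under consideration.\<close>

lemma canonical_rel_witness:
  assumes u: "logic_hom L u" and fin: "finite \<Omega>" "finite P" "finite Q"
    and oc: "order_compatible (P \<union> lower_bounds \<Omega> h) (Q \<union> upper_bounds \<Omega> h) u"
  shows "\<exists>g. logic_hom L g \<and> canonical_rel \<Omega> h g \<and> (\<forall>(\<psi>, a)\<in>P. a \<le> g \<psi>) \<and> (\<forall>(\<chi>, b)\<in>Q. g \<chi> \<le> b)"
proof -
  have "\<exists>g. logic_hom L g \<and> (\<forall>(\<psi>, a)\<in>P \<union> lower_bounds \<Omega> h. a \<le> g \<psi>) \<and>
      (\<forall>(\<chi>, b)\<in>Q \<union> upper_bounds \<Omega> h. g \<chi> \<le> b)"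
    by (rule logic_hom_interpolation[OF u _ _ _ _ _ _ oc])
      (use fin finite_bounds in \<open>auto simp: lower_bounds_def upper_bounds_def\<close>)
  then obtain g where g: "logic_hom L g" "\<forall>(\<psi>, a)\<in>P \<union> lower_bounds \<Omega> h. a \<le> g \<psi>"
    "\<forall>(\<chi>, b)\<in>Q \<union> upper_bounds \<Omega> h. g \<chi> \<le> b" by blast
  then have "canonical_rel \<Omega> h g"
    unfolding canonical_rel_def by (auto simp: lower_bounds_def upper_bounds_def)
  then show ?thesis using g by blast
qed

text \<open>Distribution of \<diamond> over \<or> bounds the value by a maximum of finitely many
  values below \<open>c\<close>. The empty disjunction is settled by \<not>\<diamond>\<bottom> and
  \<open>0 < c\<close>.\<close>

lemma logic_hom_Dia_Disj_less:
  assumes h: "logic_hom L h" and F: "L (\<^bold>\<not> \<^bold>\<diamond> \<^bold>\<bottom>)"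
    and D: "\<And>\<phi> \<psi>. L (\<^bold>\<diamond> (\<phi> \<^bold>\<or> \<psi>) \<^bold>\<rightarrow> (\<^bold>\<diamond> \<phi> \<^bold>\<or> \<^bold>\<diamond> \<psi>))"
    and c: "0 < c" "\<And>\<phi>. \<phi> \<in> set \<phi>s \<Longrightarrow> h (\<^bold>\<diamond> \<phi>) < c"
  shows "h (\<^bold>\<diamond> (Disj \<phi>s)) < c"
proof -
  have g: "goedel_hom h" using h by (simp add: logic_hom_def)
  show ?thesis using c(2)
  proof (induction \<phi>s)
    case Nil
    then show ?case using logic_hom_Imp[OF h F] c(1) by (simp add: goedel_hom_simps[OF g])
  next
    case (Cons \<phi> \<phi>s)
    then have "h (\<^bold>\<diamond> \<phi>) < c" "h (\<^bold>\<diamond> (Disj \<phi>s)) < c" by auto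
    then show ?case
      using logic_hom_Imp[OF h D[of \<phi> "Disj \<phi>s"]] by (simp add: goedel_hom_simps[OF g])
  qed
qed

lemma Dia_le_upper_bounds:
  assumes h: "logic_hom L h" and F: "L (\<^bold>\<not> \<^bold>\<diamond> \<^bold>\<bottom>)" and \<chi>: "(\<chi>, b) \<in> upper_bounds \<Omega> h"
  shows "h (\<^bold>\<diamond> \<chi>) \<le> b"
proof -
  have g: "goedel_hom h" using h by (simp add: logic_hom_def)
  have "h (\<^bold>\<diamond> \<^bold>\<bottom>) \<le> 0" using logic_hom_Imp[OF h F] by (simp add: goedel_hom_simps[OF g])
  then show ?thesis using \<chi> goedel_hom_simps(6)[OF g] by (auto simp: upper_bounds_def)
qed

lemma finite_list_of_bounds:
  assumes "finite Q"
  obtains X where "set X = {\<chi>. \<exists>b. (\<chi>, b) \<in> Q \<and> p b}"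
proof -
  have "finite {\<chi>. \<exists>b. (\<chi>, b) \<in> Q \<and> p b}"
    by (rule finite_subset[of _ "fst ` Q"]) (use assms in force)+
  from finite_list[OF this] show ?thesis using that by (rule exE)
qed

section \<open>Existence of successors for \<open>KG\<close>\<close>

interpretation KG: goedel_logic KG
  by standard (auto intro: KG.intros)

context
  fixes h assumes h: "logic_hom KG h"
begin

lemma goedel_hom_KG_hom: "goedel_hom h"
  using h by (simp add: logic_hom_def)

lemmas KG_hom_simps = goedel_hom_simps[OF goedel_hom_KG_hom]

lemma KG_hom_theorem: "KG \<theta> \<Longrightarrow> h \<theta> = 1"
  using h by (simp add: logic_hom_def)

lemma KG_hom_Box_mono: "KG (\<phi> \<^bold>\<rightarrow> \<psi>) \<Longrightarrow> h (\<^bold>\<box> \<phi>) \<le> h (\<^bold>\<box> \<psi>)"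
  by (rule logic_hom_Imp[OF h]) (meson KG.intros)

lemma KG_hom_Dia_mono: "KG (\<phi> \<^bold>\<rightarrow> \<psi>) \<Longrightarrow> h (\<^bold>\<diamond> \<phi>) \<le> h (\<^bold>\<diamond> \<psi>)"
  by (rule logic_hom_Imp[OF h]) (meson KG.intros)

lemma KG_hom_K: "min (h (\<^bold>\<box> (\<phi> \<^bold>\<rightarrow> \<psi>))) (h (\<^bold>\<box> \<phi>)) \<le> h (\<^bold>\<box> \<psi>)"
  using logic_hom_Imp[OF h KG_K_box[of \<phi> \<psi>]] by (simp add: KG_hom_simps le_gimp_iff)

lemma KG_hom_FS1: "min (h (\<^bold>\<diamond> (\<phi> \<^bold>\<rightarrow> \<psi>))) (h (\<^bold>\<box> \<phi>)) \<le> h (\<^bold>\<diamond> \<psi>)"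
  using logic_hom_Imp[OF h KG_FS1[of \<phi> \<psi>]] by (simp add: KG_hom_simps le_gimp_iff)

lemma KG_hom_FS2: "h (\<^bold>\<diamond> \<phi>) \<le> h (\<^bold>\<box> \<psi>) \<Longrightarrow> h (\<^bold>\<box> (\<phi> \<^bold>\<rightarrow> \<psi>)) = 1"
  using logic_hom_Imp[OF h KG_FS2[of \<phi> \<psi>]] KG_hom_simps(6)[of "\<^bold>\<box> (\<phi> \<^bold>\<rightarrow> \<psi>)"]
  by (simp add: KG_hom_simps gimp_def)

text \<open>Monotonicity of \<diamond> along \<phi> \<rightarrow> ((\<phi> \<rightarrow> \<psi>)
  \<rightarrow> \<psi>), followed by FS1.\<close>

lemma KG_hom_K_Dia: "min (h (\<^bold>\<box> (\<phi> \<^bold>\<rightarrow> \<psi>))) (h (\<^bold>\<diamond> \<phi>)) \<le> h (\<^bold>\<diamond> \<psi>)"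
proof -
  have "KG (\<phi> \<^bold>\<rightarrow> (\<phi> \<^bold>\<rightarrow> \<psi>) \<^bold>\<rightarrow> \<psi>)"
  proof (rule KG.theoremI)
    fix u assume "logic_hom KG u"
    then have g: "goedel_hom u" by (simp add: logic_hom_def)
    show "u (\<phi> \<^bold>\<rightarrow> (\<phi> \<^bold>\<rightarrow> \<psi>) \<^bold>\<rightarrow> \<psi>) = 1"
      using goedel_hom_simps(6)[OF g, of \<phi>] by (simp add: goedel_hom_simps[OF g] gimp_def)
  qed
  from KG_hom_Dia_mono[OF this] KG_hom_FS1[of "\<phi> \<^bold>\<rightarrow> \<psi>" \<psi>] show ?thesis by (auto simp: min_def split: if_splits)
qed

lemma KG_hom_Dia_Disj_less:
  "0 < c \<Longrightarrow> (\<And>\<phi>. \<phi> \<in> set \<phi>s \<Longrightarrow> h (\<^bold>\<diamond> \<phi>) < c) \<Longrightarrow> h (\<^bold>\<diamond> (Disj \<phi>s)) < c"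
  using logic_hom_Dia_Disj_less[OF h KG_F_dia KG_D_dia] .

lemma KG_hom_Box_Conj_ge: "c \<le> 1 \<Longrightarrow> (\<And>\<phi>. \<phi> \<in> set \<phi>s \<Longrightarrow> c \<le> h (\<^bold>\<box> \<phi>)) \<Longrightarrow> c \<le> h (\<^bold>\<box> (Conj \<phi>s))"
proof (induction \<phi>s)
  case Nil
  have "KG (\<^bold>\<box> \<^bold>\<not> \<^bold>\<bottom>)" by (intro KG_nec_box KG_goedel goedel_axiom.intros)
  then show ?case using KG_hom_theorem Nil by simp
next
  case (Cons \<phi> \<phi>s)
  have "h (\<^bold>\<box> \<phi>) \<le> h (\<^bold>\<box> (Conj \<phi>s \<^bold>\<rightarrow> \<phi> \<^bold>\<and> Conj \<phi>s))"
    by (intro KG_hom_Box_mono KG_goedel goedel_axiom.intros)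
  then show ?case using Cons KG_hom_K[of "Conj \<phi>s" "\<phi> \<^bold>\<and> Conj \<phi>s"] by force
qed

text \<open>A derivation can be boxed line by line: necessitation handles theorems, the K axiom
  handles modus ponens.\<close>

lemma KG_hom_Box_derives: "derives KG \<Theta> \<xi> \<Longrightarrow> (\<And>\<theta>. \<theta> \<in> \<Theta> \<Longrightarrow> h (\<^bold>\<box> \<theta>) = 1) \<Longrightarrow> h (\<^bold>\<box> \<xi>) = 1"
proof (induction rule: derives.induct)
  case (derives_theorem \<phi>)
  then show ?case by (intro KG_hom_theorem KG_nec_box)
next
  case (derives_MP \<phi> \<psi>)
  then show ?case using KG_hom_K[of \<phi> \<psi>] KG_hom_simps(6)[of "\<^bold>\<box> \<psi>"] by simp
qed auto

text \<open>Order-compatible homomorphisms are those making every formula of \<open>\<Theta>\<close> true and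
  every disjunct of \<open>\<Upsilon>\<close> less than 1. The relation to \<open>h\<close> is that \<open>\<box>\<theta>\<close> is true for
  \<open>\<theta> \<in> \<Theta>\<close> by FS2, while \<open>\<diamond>\<Upsilon>\<close> is less than 1 by FS1.\<close>

lemma order_compatible_axiomatization:
  assumes fin: "finite \<Omega>"
  shows "\<exists>\<Theta> \<Upsilon>. (\<forall>\<theta>\<in>\<Theta>. h (\<^bold>\<box> \<theta>) = 1) \<and> h (\<^bold>\<diamond> (Disj \<Upsilon>)) < 1 \<and>
    (\<forall>u. logic_hom KG u \<longrightarrow> (\<forall>\<theta>\<in>\<Theta>. u \<theta> = 1) \<longrightarrow> u (Disj \<Upsilon>) < 1 \<longrightarrow>
       order_compatible (lower_bounds \<Omega> h) (upper_bounds \<Omega> h) u)"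
proof -
  let ?P = "lower_bounds \<Omega> h" and ?Q = "upper_bounds \<Omega> h"
  have top: "h (\<^bold>\<box> \<^bold>\<not> \<^bold>\<bottom>) = 1" using KG_hom_Box_Conj_ge[of 1 "[]"] KG_hom_simps(6)[of "\<^bold>\<box> \<^bold>\<not> \<^bold>\<bottom>"] by simp
  have P: "a \<le> h (\<^bold>\<box> \<psi>)" if "(\<psi>, a) \<in> ?P" for \<psi> a
    using that top KG_hom_simps(5) by (auto simp: lower_bounds_def)
  note Q = Dia_le_upper_bounds[OF h KG_F_dia]
  define \<Theta> where "\<Theta> = {\<chi> \<^bold>\<rightarrow> \<psi> |\<psi> \<chi> a. (\<psi>, a) \<in> ?P \<and> (\<chi>, a) \<in> ?Q}"
  define Y where "Y = (\<lambda>((\<psi>, a), (\<chi>, b)). \<psi> \<^bold>\<rightarrow> \<chi>) ` {((\<psi>, a), (\<chi>, b)) |\<psi> a \<chi> b. (\<psi>, a) \<in> ?P \<and> (\<chi>, b) \<in> ?Q \<and> b < a}"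
  have "finite {((\<psi>, a), (\<chi>, b)) |\<psi> a \<chi> b. (\<psi>, a) \<in> ?P \<and> (\<chi>, b) \<in> ?Q \<and> b < a}"
    by (rule finite_subset[of _ "?P \<times> ?Q"]) (use finite_bounds[OF fin] in auto)
  then have "finite Y" unfolding Y_def by (rule finite_imageI)
  then obtain \<Upsilon> where \<Upsilon>: "set \<Upsilon> = Y" using finite_list by blast
  have Y: "\<xi> \<in> Y \<longleftrightarrow> (\<exists>\<psi> a \<chi> b. \<xi> = \<psi> \<^bold>\<rightarrow> \<chi> \<and> (\<psi>, a) \<in> ?P \<and> (\<chi>, b) \<in> ?Q \<and> b < a)" for \<xi>
    unfolding Y_def by (force simp: image_iff)
  show ?thesis
  proof (intro exI conjI allI impI)
    show "\<forall>\<theta>\<in>\<Theta>. h (\<^bold>\<box> \<theta>) = 1"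
      using P Q KG_hom_FS2 unfolding \<Theta>_def by (force intro: order_trans)
    show "h (\<^bold>\<diamond> (Disj \<Upsilon>)) < 1"
    proof (rule KG_hom_Dia_Disj_less)
      fix \<xi> assume "\<xi> \<in> set \<Upsilon>"
      then obtain \<psi> a \<chi> b where *: "\<xi> = \<psi> \<^bold>\<rightarrow> \<chi>" "(\<psi>, a) \<in> ?P" "(\<chi>, b) \<in> ?Q" "b < a"
        unfolding \<Upsilon> Y by blast
      \<comment> \<open>FS1 bounds the smaller of \<open>h (\<diamond>\<xi>)\<close> and
        \<open>h (\<box>\<psi>)\<close> by \<open>b\<close>. As
        \<open>b < a \<le> h (\<box>\<psi>)\<close>, the smaller one is
        \<open>h (\<diamond>\<xi>)\<close>, and it lies below 1.\<close>
      then show "h (\<^bold>\<diamond> \<xi>) < 1"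
        using P[OF *(2)] Q[OF *(3)] KG_hom_FS1[of \<psi> \<chi>] KG_hom_simps(6)[of "\<^bold>\<box> \<psi>"] by (auto simp: min_def split: if_splits)
    qed simp
    fix u assume u: "logic_hom KG u" "\<forall>\<theta>\<in>\<Theta>. u \<theta> = 1" "u (Disj \<Upsilon>) < 1"
    then have g: "goedel_hom u" by (simp add: logic_hom_def)
    have "u \<chi> \<le> u \<psi>" if "(\<psi>, a) \<in> ?P" "(\<chi>, a) \<in> ?Q" for \<psi> \<chi> a
    proof -
      have "u (\<chi> \<^bold>\<rightarrow> \<psi>) = 1" using u(2) that unfolding \<Theta>_def by blast
      then show ?thesis by (simp add: goedel_hom_simps[OF g] gimp_eq_1_iff)
    qed
    moreover have "u \<chi> < u \<psi>" if "(\<psi>, a) \<in> ?P" "(\<chi>, b) \<in> ?Q" "b < a" for \<psi> \<chi> a b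
    proof -
      have "\<psi> \<^bold>\<rightarrow> \<chi> \<in> set \<Upsilon>" using \<Upsilon> Y that by blast
      from goedel_hom_Disj_ge[OF g this] u(3) show ?thesis
        by (simp add: goedel_hom_simps[OF g] gimp_def split: if_splits)
    qed
    ultimately show "order_compatible ?P ?Q u" unfolding order_compatible_def by blast
  qed
qed

text \<open>A homomorphism making all of \<Theta> true either is compatible, and then makes \<xi>
  true, or makes the disjunction of \<Upsilon> true. By completeness \<Theta> derives \<xi> \<or>
  \<open>Disj \<Upsilon>\<close>. Boxing this and applying the axiom \<open>KG_Dunn\<close> leaves
  \<box>\<xi>, because \<diamond> of \<open>Disj \<Upsilon>\<close> is less than 1.\<close>

lemma order_compatible_Box:
  assumes fin: "finite \<Omega>"
    and valid: "\<And>u. logic_hom KG u \<Longrightarrow> order_compatible (lower_bounds \<Omega> h) (upper_bounds \<Omega> h) u \<Longrightarrow> u \<xi> = 1"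
  shows "h (\<^bold>\<box> \<xi>) = 1"
proof -
  obtain \<Theta> \<Upsilon> where \<Theta>: "\<forall>\<theta>\<in>\<Theta>. h (\<^bold>\<box> \<theta>) = 1" and \<Upsilon>: "h (\<^bold>\<diamond> (Disj \<Upsilon>)) < 1"
    and oc: "\<forall>u. logic_hom KG u \<longrightarrow> (\<forall>\<theta>\<in>\<Theta>. u \<theta> = 1) \<longrightarrow> u (Disj \<Upsilon>) < 1 \<longrightarrow>
      order_compatible (lower_bounds \<Omega> h) (upper_bounds \<Omega> h) u"
    using order_compatible_axiomatization[OF fin] by auto
  have "derives KG \<Theta> (\<xi> \<^bold>\<or> Disj \<Upsilon>)"
  proof (rule KG.derivesI)
    fix u assume u: "logic_hom KG u" "\<And>\<theta>. \<theta> \<in> \<Theta> \<Longrightarrow> u \<theta> = 1"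
    then have g: "goedel_hom u" by (simp add: logic_hom_def)
    show "u (\<xi> \<^bold>\<or> Disj \<Upsilon>) = 1"
      using valid[OF u(1)] oc u goedel_hom_simps(6)[OF g]
      by (cases "u (Disj \<Upsilon>) < 1")
        (auto simp: goedel_hom_simps(3)[OF g] max.absorb1 max.absorb2 not_less intro: order_antisym)
  qed
  then have "h (\<^bold>\<box> (\<xi> \<^bold>\<or> Disj \<Upsilon>)) = 1" using KG_hom_Box_derives \<Theta> by blast
  then have "1 \<le> max (h (\<^bold>\<box> \<xi>)) (h (\<^bold>\<diamond> (Disj \<Upsilon>)))"
    using logic_hom_Imp[OF h KG_Dunn[of \<xi> "Disj \<Upsilon>"]] by (simp add: KG_hom_simps)
  then show ?thesis using \<Upsilon> KG_hom_simps(6)[of "\<^bold>\<box> \<xi>"] by (auto simp: max_def split: if_splits)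
qed

text \<open>\<open>X\<close> lists the formulas whose upper bound is at most \<open>d\<close>. If
  all compatible homomorphisms made \<phi> \<rightarrow> \<open>Disj X\<close> true, its box would
  be true and \<diamond>\<phi> would be at most \<diamond> of \<open>Disj X\<close>, which is too
  small. A homomorphism refuting the implication puts \<phi> strictly above \<open>X\<close>, so the
  demand \<open>d \<le> g \<phi>\<close> is compatible.\<close>

lemma KG_dia_existence:
  assumes fin: "finite \<Omega>" and c: "0 \<le> c" "c < h (\<^bold>\<diamond> \<phi>)"
  obtains g where "logic_hom KG g" "canonical_rel \<Omega> h g" "c < g \<phi>"
proof -
  \<comment> \<open>The midpoint leaves room on both sides: \<open>c < d\<close> makes the final
    inequality strict, and \<open>d < h (\<diamond>\<phi>)\<close> keeps the diamonds of
    \<open>X\<close> strictly below \<diamond>\<phi>.\<close>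
  define d where "d = (c + h (\<^bold>\<diamond> \<phi>)) / 2"
  have d: "c < d" "d < h (\<^bold>\<diamond> \<phi>)" using c by (auto simp: d_def)
  let ?P = "lower_bounds \<Omega> h" and ?Q = "upper_bounds \<Omega> h"
  obtain X where X: "set X = {\<chi>. \<exists>b. (\<chi>, b) \<in> ?Q \<and> b \<le> d}"
    by (rule finite_list_of_bounds[OF finite_bounds(2)[OF fin]])
  have "h (\<^bold>\<diamond> (Disj X)) < h (\<^bold>\<diamond> \<phi>)"
  proof (rule KG_hom_Dia_Disj_less)
    fix \<chi> assume "\<chi> \<in> set X"
    then show "h (\<^bold>\<diamond> \<chi>) < h (\<^bold>\<diamond> \<phi>)"
      using Dia_le_upper_bounds[OF h KG_F_dia] d unfolding X by force
  qed (use c in simp)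
  then have "h (\<^bold>\<box> (\<phi> \<^bold>\<rightarrow> Disj X)) \<noteq> 1"
    using KG_hom_K_Dia[of \<phi> "Disj X"] KG_hom_simps(6)[of "\<^bold>\<diamond> \<phi>"] by (auto simp: min_def split: if_splits)
  then obtain u where u: "logic_hom KG u" "order_compatible ?P ?Q u" "u (\<phi> \<^bold>\<rightarrow> Disj X) \<noteq> 1"
    using order_compatible_Box[OF fin] by blast
  then have g: "goedel_hom u" by (simp add: logic_hom_def)
  have "u \<chi> < u \<phi>" if "(\<chi>, b) \<in> ?Q" "b \<le> d" for \<chi> b
    using u(3) goedel_hom_Disj_ge[OF g, of \<chi> X] that X by (force simp: goedel_hom_simps(4)[OF g] gimp_def split: if_splits)
  then have "order_compatible ({(\<phi>, d)} \<union> ?P) ({} \<union> ?Q) u"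
    using u(2) unfolding order_compatible_def by fastforce
  from canonical_rel_witness[OF u(1) fin _ _ this] obtain g where
    "logic_hom KG g" "canonical_rel \<Omega> h g" "d \<le> g \<phi>" by auto
  then show ?thesis using that d by force
qed

text \<open>Here \<phi> can join the premises \<Theta>: a derivation of
  \<open>Disj \<Upsilon>\<close> from both would give \<box>(\<phi> \<rightarrow>
  \<open>Disj \<Upsilon>\<close>) and so a value below 1 for \<diamond>\<phi>. The separating
  homomorphism has value 1 at \<phi>, and rescaling keeps it.\<close>

lemma KG_dia1_existence:
  assumes fin: "finite \<Omega>" and 1: "h (\<^bold>\<diamond> \<phi>) = 1"
  obtains g where "logic_hom KG g" "canonical_rel \<Omega> h g" "g \<phi> = 1"
proof -
  let ?P = "lower_bounds \<Omega> h" and ?Q = "upper_bounds \<Omega> h"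
  obtain \<Theta> \<Upsilon> where \<Theta>: "\<forall>\<theta>\<in>\<Theta>. h (\<^bold>\<box> \<theta>) = 1" and \<Upsilon>: "h (\<^bold>\<diamond> (Disj \<Upsilon>)) < 1"
    and oc: "\<forall>u. logic_hom KG u \<longrightarrow> (\<forall>\<theta>\<in>\<Theta>. u \<theta> = 1) \<longrightarrow> u (Disj \<Upsilon>) < 1 \<longrightarrow>
      order_compatible ?P ?Q u"
    using order_compatible_axiomatization[OF fin] by auto
  have "\<not> derives KG (insert \<phi> \<Theta>) (Disj \<Upsilon>)"
  proof
    assume "derives KG (insert \<phi> \<Theta>) (Disj \<Upsilon>)"
    then have "h (\<^bold>\<box> (\<phi> \<^bold>\<rightarrow> Disj \<Upsilon>)) = 1" using KG_hom_Box_derives KG.deduction \<Theta> by blast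
    then show False using KG_hom_K_Dia[of \<phi> "Disj \<Upsilon>"] 1 \<Upsilon> by simp
  qed
  then obtain u where u: "logic_hom KG u" "\<forall>\<theta>\<in>insert \<phi> \<Theta>. u \<theta> = 1" "u (Disj \<Upsilon>) < 1"
    by (rule KG.hom_separation)
  have oc': "order_compatible ?P ?Q u" using u oc by auto
  have g: "goedel_hom u" and u\<phi>: "u \<phi> = 1" using u by (auto simp: logic_hom_def)
  have top: "(\<^bold>\<not> \<^bold>\<bottom>, 1) \<in> ?P" by (simp add: lower_bounds_def)
  \<comment> \<open>Compatibility with the constant lower bound (\<not>\<bottom>, 1) keeps every
    formula with upper bound below 1 strictly below 1; hence the demand 1 at \<phi> can be
    added.\<close>
  have "u \<chi> < 1" if "(\<chi>, b) \<in> ?Q" "b < 1" for \<chi> b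
    using oc' top that goedel_hom_simps(6)[OF g, of "\<^bold>\<not> \<^bold>\<bottom>"] unfolding order_compatible_def by fastforce
  then have "order_compatible ({(\<phi>, 1)} \<union> ?P) ({} \<union> ?Q) u"
    using oc' u\<phi> goedel_hom_simps(6)[OF g] unfolding order_compatible_def by auto
  from canonical_rel_witness[OF u(1) fin _ _ this] obtain g where
    g: "logic_hom KG g" "canonical_rel \<Omega> h g" "1 \<le> g \<phi>" by auto
  then have "g \<phi> = 1" using goedel_hom_simps(6)[of g \<phi>] by (auto simp: logic_hom_def)
  then show ?thesis using that g by blast
qed

text \<open>The dual argument: \<open>Conj X\<close> collects the formulas whose lower bound is at
  least \<open>d\<close>, and the K axiom replaces its \<diamond>-version. Refuting
  \<open>Conj X\<close> \<rightarrow> \<phi> puts \<phi> strictly below all of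
  \<open>X\<close>.\<close>

lemma KG_box_existence:
  assumes fin: "finite \<Omega>" and c: "c \<le> 1" "h (\<^bold>\<box> \<phi>) < c"
  obtains g where "logic_hom KG g" "canonical_rel \<Omega> h g" "g \<phi> < c"
proof -
  define d where "d = (c + h (\<^bold>\<box> \<phi>)) / 2"
  have d: "d < c" "h (\<^bold>\<box> \<phi>) < d" using c by (auto simp: d_def)
  let ?P = "lower_bounds \<Omega> h" and ?Q = "upper_bounds \<Omega> h"
  obtain X where X: "set X = {\<psi>. \<exists>a. (\<psi>, a) \<in> ?P \<and> d \<le> a}"
    by (rule finite_list_of_bounds[OF finite_bounds(1)[OF fin]])
  have "d \<le> h (\<^bold>\<box> (Conj X))"
  proof (rule KG_hom_Box_Conj_ge)
    have top: "h (\<^bold>\<box> \<^bold>\<not> \<^bold>\<bottom>) \<ge> 1" using KG_hom_Box_Conj_ge[of 1 "[]"] by simp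
    fix \<psi> assume "\<psi> \<in> set X"
    then show "d \<le> h (\<^bold>\<box> \<psi>)"
      using top d c KG_hom_simps(5)[of "\<^bold>\<box> \<phi>"] unfolding X by (auto simp: lower_bounds_def)
  qed (use c d in simp)
  then have "h (\<^bold>\<box> (Conj X \<^bold>\<rightarrow> \<phi>)) \<noteq> 1"
    using KG_hom_K[of "Conj X" \<phi>] d c by (auto simp: min_def split: if_splits)
  then obtain u where u: "logic_hom KG u" "order_compatible ?P ?Q u" "u (Conj X \<^bold>\<rightarrow> \<phi>) \<noteq> 1"
    using order_compatible_Box[OF fin] by blast
  then have g: "goedel_hom u" by (simp add: logic_hom_def)
  have "u \<phi> < u \<psi>" if "(\<psi>, a) \<in> ?P" "d \<le> a" for \<psi> a
    using u(3) goedel_hom_Conj_le[OF g, of \<psi> X] that X by (force simp: goedel_hom_simps(4)[OF g] gimp_def split: if_splits)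
  then have "order_compatible ({} \<union> ?P) ({(\<phi>, d)} \<union> ?Q) u"
    using u(2) unfolding order_compatible_def by fastforce
  from canonical_rel_witness[OF u(1) fin _ _ this] obtain g where
    "logic_hom KG g" "canonical_rel \<Omega> h g" "g \<phi> \<le> d" by auto
  then show ?thesis using that d by force
qed

end

section \<open>The \<diamond>-fragment and its successors\<close>

primrec box_free :: "fm \<Rightarrow> fm" where
  "box_free (Var p) = Var p"
| "box_free \<^bold>\<bottom> = \<^bold>\<bottom>"
| "box_free (\<phi> \<^bold>\<and> \<psi>) = box_free \<phi> \<^bold>\<and> box_free \<psi>"
| "box_free (\<phi> \<^bold>\<or> \<psi>) = box_free \<phi> \<^bold>\<or> box_free \<psi>"
| "box_free (\<phi> \<^bold>\<rightarrow> \<psi>) = box_free \<phi> \<^bold>\<rightarrow> box_free \<psi>"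
| "box_free (\<^bold>\<box> \<phi>) = \<^bold>\<bottom>"
| "box_free (\<^bold>\<diamond> \<phi>) = \<^bold>\<diamond> (box_free \<phi>)"

lemma dia_language_simps [simp]:
  "Var p \<in> dia_language" "\<^bold>\<bottom> \<in> dia_language"
  "\<phi> \<^bold>\<and> \<psi> \<in> dia_language \<longleftrightarrow> \<phi> \<in> dia_language \<and> \<psi> \<in> dia_language"
  "\<phi> \<^bold>\<or> \<psi> \<in> dia_language \<longleftrightarrow> \<phi> \<in> dia_language \<and> \<psi> \<in> dia_language"
  "\<phi> \<^bold>\<rightarrow> \<psi> \<in> dia_language \<longleftrightarrow> \<phi> \<in> dia_language \<and> \<psi> \<in> dia_language"
  "\<^bold>\<box> \<phi> \<notin> dia_language" "\<^bold>\<diamond> \<phi> \<in> dia_language \<longleftrightarrow> \<phi> \<in> dia_language"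
  by (auto simp: dia_language_def)

lemma box_free_in_dia_language: "box_free \<phi> \<in> dia_language"
  by (induction \<phi>) auto

lemma box_free_id: "\<phi> \<in> dia_language \<Longrightarrow> box_free \<phi> = \<phi>"
  by (induction \<phi>) auto

lemma goedel_axiom_box_free: "goedel_axiom \<phi> \<Longrightarrow> goedel_axiom (box_free \<phi>)"
  by (induction rule: goedel_axiom.induct) (auto intro: goedel_axiom.intros)

text \<open>Reading every boxed formula as \<open>\<bottom>\<close> extends \<open>KG_dia\<close> conservatively to a logic in the
  full language.\<close>

abbreviation KG_dia_ext :: "fm \<Rightarrow> bool" where
  "KG_dia_ext \<theta> \<equiv> KG_dia (box_free \<theta>)"

interpretation KG_dia: goedel_logic KG_dia_ext
  by standard
    (auto intro: KGd_goedel goedel_axiom_box_free box_free_in_dia_language KGd_MP)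

lemma derives_KG_dia_ext:
  "derives KG_dia_ext \<Gamma> \<phi> \<Longrightarrow> derives KG_dia (box_free ` \<Gamma>) (box_free \<phi>)"
  by (induction rule: derives.induct) (auto intro: derives.intros)

text \<open>One use of \<open>KGd_rule\<close> replaces the \<box>-axioms. Its premise gathers all
  that must be refuted: \<phi> below the formulas \<open>X\<close> with bound at most
  \<open>d\<close>, value 1 for a formula of \<open>Y\<close> with bound below 1, and a nonzero
  value for a formula of \<open>N\<close> with bound 0. Were it a theorem, \<open>h\<close> would
  satisfy the conclusion of the rule, which the bounds on \<diamond> exclude.\<close>

lemma KG_dia_ext_dia_existence:
  assumes h: "logic_hom KG_dia_ext h" and fin: "finite \<Omega>" and \<Omega>: "\<Omega> \<subseteq> dia_language"
    and c: "0 \<le> c" "c < h (\<^bold>\<diamond> \<phi>)"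
  obtains g where "logic_hom KG_dia_ext g" "canonical_rel \<Omega> h g" "c < g \<phi>"
proof -
  let ?P = "lower_bounds \<Omega> h" and ?Q = "upper_bounds \<Omega> h"
  have g: "goedel_hom h" using h by (simp add: logic_hom_def)
  note hs = goedel_hom_simps[OF g]
  have F: "KG_dia_ext (\<^bold>\<not> \<^bold>\<diamond> \<^bold>\<bottom>)" by (simp add: KGd_F_dia)
  have D: "KG_dia_ext (\<^bold>\<diamond> (\<alpha> \<^bold>\<or> \<beta>) \<^bold>\<rightarrow> (\<^bold>\<diamond> \<alpha> \<^bold>\<or> \<^bold>\<diamond> \<beta>))" for \<alpha> \<beta>
    by (simp add: KGd_D_dia box_free_in_dia_language)
  have Z: "KG_dia_ext (\<^bold>\<diamond> \<^bold>\<not> \<^bold>\<not> \<alpha> \<^bold>\<rightarrow> \<^bold>\<not> \<^bold>\<not> \<^bold>\<diamond> \<alpha>)" for \<alpha>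
    by (simp add: KGd_Z_dia box_free_in_dia_language)
  note Q = Dia_le_upper_bounds[OF h F]
  note less = logic_hom_Dia_Disj_less[OF h F D]
  define d where "d = (c + h (\<^bold>\<diamond> \<phi>)) / 2"
  have d: "c < d" "d < h (\<^bold>\<diamond> \<phi>)" using c by (auto simp: d_def)
  note flb = finite_list_of_bounds[OF finite_bounds(2)[OF fin]]
  obtain X where X: "set X = {\<chi>. \<exists>b. (\<chi>, b) \<in> ?Q \<and> b \<le> d}" by (rule flb)
  obtain Y where Y: "set Y = {\<chi>. \<exists>b. (\<chi>, b) \<in> ?Q \<and> b < 1}" by (rule flb)
  obtain N where N: "set N = {\<chi>. \<exists>b. (\<chi>, b) \<in> ?Q \<and> b = 0}" by (rule flb)
  \<comment> \<open>The double negation takes only the values 0 and 1, so refuting it forces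
    \<open>Disj N\<close> to be exactly 0. Axiom \<open>KGd_Z_dia\<close> keeps its diamond at 0
    under \<open>h\<close>.\<close>
  let ?N = "\<^bold>\<not> \<^bold>\<not> Disj N"
  have hX: "h (\<^bold>\<diamond> (Disj X)) < h (\<^bold>\<diamond> \<phi>)"
    by (rule less) (use c d Q X in force)+
  have hY: "h (\<^bold>\<diamond> (Disj Y)) < 1"
    by (rule less) (use Q Y in force)+
  have "h (\<^bold>\<diamond> (Disj N)) < e" if "0 < e" for e
    by (rule less) (use that Q N in force)+
  then have "h (\<^bold>\<diamond> (Disj N)) \<le> 0" by (meson less_irrefl not_less)
  then have hN: "h (\<^bold>\<diamond> ?N) \<le> 0"
    using logic_hom_Imp[OF h Z[of "Disj N"]] hs(5)[of "\<^bold>\<diamond> Disj N"] by (simp add: hs gimp_def)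
  have "\<not> KG_dia_ext ((\<phi> \<^bold>\<rightarrow> Disj X \<^bold>\<or> ?N) \<^bold>\<or> (Disj Y \<^bold>\<or> ?N))"
  proof
    assume "KG_dia_ext ((\<phi> \<^bold>\<rightarrow> Disj X \<^bold>\<or> ?N) \<^bold>\<or> (Disj Y \<^bold>\<or> ?N))"
    then have "KG_dia_ext ((\<^bold>\<diamond> \<phi> \<^bold>\<rightarrow> \<^bold>\<diamond> (Disj X \<^bold>\<or> ?N)) \<^bold>\<or> \<^bold>\<diamond> (Disj Y \<^bold>\<or> ?N))"
      by (simp add: KGd_rule)
    then have "h ((\<^bold>\<diamond> \<phi> \<^bold>\<rightarrow> \<^bold>\<diamond> (Disj X \<^bold>\<or> ?N)) \<^bold>\<or> \<^bold>\<diamond> (Disj Y \<^bold>\<or> ?N)) = 1"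
      using h unfolding logic_hom_def by blast
    then have "h (\<^bold>\<diamond> \<phi>) \<le> h (\<^bold>\<diamond> (Disj X \<^bold>\<or> ?N)) \<or> h (\<^bold>\<diamond> (Disj Y \<^bold>\<or> ?N)) = 1"
      using gimp_eq_1_iff[OF hs(6)] by (auto simp: hs(3,4) max_def split: if_splits)
    moreover have "h (\<^bold>\<diamond> (Disj X \<^bold>\<or> ?N)) \<le> max (h (\<^bold>\<diamond> (Disj X))) 0"
      "h (\<^bold>\<diamond> (Disj Y \<^bold>\<or> ?N)) \<le> max (h (\<^bold>\<diamond> (Disj Y))) 0"
      using logic_hom_Imp[OF h D] hN by (fastforce simp: hs(3) le_max_iff_disj)+
    ultimately show False using hX hY c by auto
  qed
  then obtain u where u: "logic_hom KG_dia_ext u" "u ((\<phi> \<^bold>\<rightarrow> Disj X \<^bold>\<or> ?N) \<^bold>\<or> (Disj Y \<^bold>\<or> ?N)) \<noteq> 1"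
    using KG_dia.theoremI by blast
  have gu: "goedel_hom u" using u by (simp add: logic_hom_def)
  note us = goedel_hom_simps[OF gu]
  have uX: "u (Disj X) < u \<phi>" and uY: "u (Disj Y) < 1" and uN: "u (Disj N) = 0"
    using u(2) us(5)[of "Disj N"] us(6)[of "Disj Y"] us(6)[of \<phi>]
    by (auto simp: us(1,3,4) gimp_def max_def split: if_splits)
  \<comment> \<open>Only the constant lower bounds 0 and 1 remain beside the demand at \<phi>; they
    are handled by \<open>N\<close> and \<open>Y\<close>, the demand by \<open>X\<close>.\<close>
  have Box: "Box -` \<Omega> = {}" using \<Omega> by auto
  have u\<phi>: "u \<chi> < u \<phi>" if "(\<chi>, b) \<in> ?Q" "b \<le> d" for \<chi> b
    using goedel_hom_Disj_ge[OF gu, of \<chi> X] X uX that by force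
  moreover have "u \<chi> \<le> u \<phi>" if "(\<chi>, d) \<in> ?Q" for \<chi>
    using u\<phi>[OF that] by simp
  moreover have "u \<chi> < 1" if "(\<chi>, b) \<in> ?Q" "b < 1" for \<chi> b
    using goedel_hom_Disj_ge[OF gu, of \<chi> Y] Y uY that by force
  moreover have "u \<chi> \<le> 0" if "(\<chi>, 0) \<in> ?Q" for \<chi>
    using goedel_hom_Disj_ge[OF gu, of \<chi> N] N uN that by force
  moreover have "0 \<le> b" if "(\<chi>, b) \<in> ?Q" for \<chi> b
    using Q[OF that] hs(5)[of "\<^bold>\<diamond> \<chi>"] by simp
  moreover have "u (\<^bold>\<not> \<^bold>\<bottom>) = 1" by (simp add: us gimp_def)
  ultimately have "order_compatible ({(\<phi>, d)} \<union> ?P) ({} \<union> ?Q) u"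
    unfolding order_compatible_def lower_bounds_def Box using us(1,6)
    by (auto simp: not_less[symmetric])
  from canonical_rel_witness[OF u(1) fin _ _ this] obtain g where
    "logic_hom KG_dia_ext g" "canonical_rel \<Omega> h g" "d \<le> g \<phi>" by auto
  then show ?thesis using that d by force
qed

section \<open>Limits of canonical models\<close>

text \<open>Each predicate is constant on some subsequence of any given sequence, and a diagonal
  sequence serves the countably many predicates at once.\<close>

lemma deciding_subsequence:
  fixes Q :: "'i :: countable \<Rightarrow> nat \<Rightarrow> bool"
  obtains s where "strict_mono (s :: nat \<Rightarrow> nat)"
    "\<And>i. (\<forall>\<^sub>F n in sequentially. Q i (s n)) \<or> (\<forall>\<^sub>F n in sequentially. \<not> Q i (s n))"
proof -
  define P where "P j r \<longleftrightarrow> (\<forall>k. Q (from_nat j) (r k)) \<or> (\<forall>k. \<not> Q (from_nat j) (r k))"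
    for j and r :: "nat \<Rightarrow> nat"
  interpret subseqs P
  proof
    fix j and r :: "nat \<Rightarrow> nat"
    have "infinite {k. Q (from_nat j) (r k)} \<or> infinite {k. \<not> Q (from_nat j) (r k)}"
    proof -
      have "{k. Q (from_nat j) (r k)} \<union> {k. \<not> Q (from_nat j) (r k)} = UNIV" by auto
      then show ?thesis by (metis finite_Un infinite_UNIV_nat)
    qed
    then show "\<exists>r'. strict_mono r' \<and> P j (r \<circ> r')"
      unfolding P_def using infinite_enumerate by (metis comp_apply mem_Collect_eq)
  qed
  have stable: "P j (r \<circ> r')" if "P j r" for j r r'
    using that by (auto simp: P_def)
  show ?thesis
  proof
    show "strict_mono diagseq" by (rule subseq_diagseq)
    fix i :: 'i
    have "P (to_nat i) (diagseq \<circ> (+) (Suc (to_nat i)))"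
      by (rule diagseq_holds) (rule stable)
    then have "(\<forall>n>to_nat i. Q i (diagseq n)) \<or> (\<forall>n>to_nat i. \<not> Q i (diagseq n))"
      unfolding P_def by (auto simp: less_iff_Suc_add)
    then show "(\<forall>\<^sub>F n in sequentially. Q i (diagseq n)) \<or> (\<forall>\<^sub>F n in sequentially. \<not> Q i (diagseq n))"
      unfolding eventually_sequentially by (metis Suc_le_eq)
  qed
qed

text \<open>Terms for a countable Skolem hull in the product of the canonical models of an increasing
  sequence of finite sets of formulas. Midpoints make the order of truth values dense.\<close>

datatype world_term =
    Root
  | Dia_succ world_term fm value_term
  | Dia1_succ world_term fm
  | Box_succ world_term fm value_term
and value_term =
    Zero
  | One
  | Val world_term fm
  | Mid value_term value_term

instance world_term :: countable by countable_datatype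
instance value_term :: countable by countable_datatype

text \<open>Existence of successors for \<box>\<phi> is asked only when \<box>\<phi> belongs to
  \<open>Lang\<close>; for the \<diamond>-language this holds vacuously.\<close>

locale saturated_logic = goedel_logic L for L +
  fixes Lang :: "fm set" and root :: "fm \<Rightarrow> real"
  assumes closed: "\<phi> \<^bold>\<and> \<psi> \<in> Lang \<Longrightarrow> \<phi> \<in> Lang \<and> \<psi> \<in> Lang"
      "\<phi> \<^bold>\<or> \<psi> \<in> Lang \<Longrightarrow> \<phi> \<in> Lang \<and> \<psi> \<in> Lang"
      "\<phi> \<^bold>\<rightarrow> \<psi> \<in> Lang \<Longrightarrow> \<phi> \<in> Lang \<and> \<psi> \<in> Lang"
      "\<^bold>\<box> \<phi> \<in> Lang \<Longrightarrow> \<phi> \<in> Lang" "\<^bold>\<diamond> \<phi> \<in> Lang \<Longrightarrow> \<phi> \<in> Lang"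
    and dia_existence: "\<lbrakk>logic_hom L h; finite \<Omega>; \<Omega> \<subseteq> Lang; 0 \<le> c; c < h (\<^bold>\<diamond> \<phi>)\<rbrakk>
      \<Longrightarrow> \<exists>g. logic_hom L g \<and> canonical_rel \<Omega> h g \<and> c < g \<phi>"
    and box_existence: "\<lbrakk>logic_hom L h; finite \<Omega>; \<Omega> \<subseteq> Lang; \<^bold>\<box> \<phi> \<in> Lang; c \<le> 1; h (\<^bold>\<box> \<phi>) < c\<rbrakk>
      \<Longrightarrow> \<exists>g. logic_hom L g \<and> canonical_rel \<Omega> h g \<and> g \<phi> < c"
    and root: "logic_hom L root"
begin

definition stage :: "nat \<Rightarrow> fm set" where
  "stage n = from_nat ` {..<n} \<inter> Lang"

lemma stage: "finite (stage n)" "stage n \<subseteq> Lang"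
  by (auto simp: stage_def)

lemma in_stage: "\<phi> \<in> Lang \<Longrightarrow> to_nat \<phi> < n \<Longrightarrow> \<phi> \<in> stage n"
  unfolding stage_def by (force simp: image_iff intro!: bexI[of _ "to_nat \<phi>"])

text \<open>The default \<open>root\<close> keeps every entry of a sequence a homomorphism, even at
  stages where the required successor does not exist. Only the eventual behaviour matters.\<close>

definition pick :: "nat \<Rightarrow> (fm \<Rightarrow> real) \<Rightarrow> ((fm \<Rightarrow> real) \<Rightarrow> bool) \<Rightarrow> fm \<Rightarrow> real" where
  "pick n h p = (if \<exists>g. logic_hom L g \<and> canonical_rel (stage n) h g \<and> p g
     then SOME g. logic_hom L g \<and> canonical_rel (stage n) h g \<and> p g else root)"

lemma pick:
  assumes "\<exists>g. logic_hom L g \<and> canonical_rel (stage n) h g \<and> p g"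
  shows "logic_hom L (pick n h p) \<and> canonical_rel (stage n) h (pick n h p) \<and> p (pick n h p)"
  using someI_ex[OF assms] unfolding pick_def if_P[OF assms] .

lemma logic_hom_pick: "logic_hom L (pick n h p)"
proof (cases "\<exists>g. logic_hom L g \<and> canonical_rel (stage n) h g \<and> p g")
  case True
  then show ?thesis using pick by blast
next
  case False
  then show ?thesis unfolding pick_def if_not_P[OF False] using root by simp
qed

primrec world :: "world_term \<Rightarrow> nat \<Rightarrow> fm \<Rightarrow> real" and val_at :: "value_term \<Rightarrow> nat \<Rightarrow> real" where
  "world Root n = root"
| "world (Dia_succ w \<phi> c) n = pick n (world w n) (\<lambda>g. val_at c n < g \<phi>)"
| "world (Dia1_succ w \<phi>) n = pick n (world w n) (\<lambda>g. g \<phi> = 1)"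
| "world (Box_succ w \<phi> c) n = pick n (world w n) (\<lambda>g. g \<phi> < val_at c n)"
| "val_at Zero n = 0"
| "val_at One n = 1"
| "val_at (Val w \<phi>) n = world w n \<phi>"
| "val_at (Mid c d) n = (val_at c n + val_at d n) / 2"

lemma logic_hom_world: "logic_hom L (world w n)"
  by (cases w) (auto simp: root logic_hom_pick)

lemma goedel_hom_world: "goedel_hom (world w n)"
  using logic_hom_world by (simp add: logic_hom_def)

lemma val_at_bounds: "0 \<le> val_at c n \<and> val_at c n \<le> 1"
  by (induction c rule: value_term.induct[where ?P1.0 = "\<lambda>_. True"])
    (auto simp: goedel_hom_simps[OF goedel_hom_world])

text \<open>Worlds are the world terms, and the value of a formula is the image of its
  \<open>Val\<close> term under an embedding of the eventual order. The witness clause is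
  conditional on successors of value 1 in \<open>L\<close>; for \<open>KG\<close> these come from
  \<open>KG_dia1_existence\<close>.\<close>

theorem limit_model:
  obtains M :: "(fm \<Rightarrow> real) gk_model" and v where
    "is_gk_model M" "crisp M" "v \<in> worlds M"
    "\<forall>\<phi>\<in>Lang. eval M \<phi> v = 1 \<longleftrightarrow> root \<phi> = 1"
    "(\<forall>h \<Omega> \<phi>. logic_hom L h \<longrightarrow> finite \<Omega> \<longrightarrow> \<Omega> \<subseteq> Lang \<longrightarrow> h (\<^bold>\<diamond> \<phi>) = 1
        \<longrightarrow> (\<exists>g. logic_hom L g \<and> canonical_rel \<Omega> h g \<and> g \<phi> = 1))
      \<longrightarrow> dia1_witnessed_on Lang M"
proof -
  obtain s where s: "strict_mono s" and "\<And>i. (\<forall>\<^sub>F n in sequentially. val_at (fst i) (s n) \<le> val_at (snd i) (s n)) \<or>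
      (\<forall>\<^sub>F n in sequentially. \<not> val_at (fst i) (s n) \<le> val_at (snd i) (s n))"
    using deciding_subsequence[of "\<lambda>i n. val_at (fst i) n \<le> val_at (snd i) n"] by blast
  from this(2)[of "(_, _)"] have decided: "(\<forall>\<^sub>F n in sequentially. val_at c (s n) \<le> val_at d (s n)) \<or>
      (\<forall>\<^sub>F n in sequentially. \<not> val_at c (s n) \<le> val_at d (s n))" for c d by simp
  \<comment> \<open>Along this filter every inequality between two terms eventually holds or
    eventually fails, so \<open>U\<close> acts like an ultrafilter on such statements and
    \<open>le\<close> is total.\<close>
  define U where "U = filtermap s sequentially"
  have U_nontriv: "U \<noteq> bot" by (simp add: U_def filtermap_bot_iff)
  define le where "le c d \<longleftrightarrow> (\<forall>\<^sub>F n in U. val_at c n \<le> val_at d n)" for c d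
  have nle: "\<not> le c d \<longleftrightarrow> (\<forall>\<^sub>F n in U. val_at d n < val_at c n)" for c d
  proof
    assume "\<not> le c d"
    then show "\<forall>\<^sub>F n in U. val_at d n < val_at c n"
      using decided[of c d] by (auto simp: le_def U_def eventually_filtermap not_le)
  next
    assume "\<forall>\<^sub>F n in U. val_at d n < val_at c n"
    then have "\<not> (\<forall>\<^sub>F n in U. \<not> val_at d n < val_at c n)"
      using U_nontriv eventually_frequently not_eventually by (metis frequently_def)
    then show "\<not> le c d" by (simp add: le_def not_less)
  qed
  have U_stage: "\<forall>\<^sub>F n in U. \<phi> \<in> stage n" if "\<phi> \<in> Lang" for \<phi>
  proof -
    have "\<forall>\<^sub>F n in sequentially. \<phi> \<in> stage n"
      using eventually_gt_at_top[of "to_nat \<phi>"] by eventually_elim (use that in_stage in blast)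
    then show ?thesis unfolding U_def eventually_filtermap
      using filterlim_subseq[OF s] unfolding filterlim_iff by blast
  qed
  have total: "le c d \<or> le d c" for c d
    using nle[of c d] eventually_mono[of "\<lambda>n. val_at d n < val_at c n" U "\<lambda>n. val_at d n \<le> val_at c n"]
    by (auto simp: le_def[of d c])
  have trans: "transp le"
    unfolding le_def by (rule transpI, erule (1) eventually_elim2) simp
  have bot: "le Zero c" and top: "le c One" for c
    using val_at_bounds by (auto simp: le_def)
  have nontriv: "\<not> le One Zero" by (simp add: nle)
  obtain f :: "value_term \<Rightarrow> real" where f_le: "\<And>c d. f c \<le> f d \<longleftrightarrow> le c d"
    and f_Zero: "f Zero = 0" and f_One: "f One = 1"
    and rc: "\<forall>x r. f x < f One \<longrightarrow> (\<forall>y. f x < f y \<longrightarrow> (\<exists>y'. f x < f y' \<and> f y' < f y)) \<longrightarrow> f x < r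
         \<longrightarrow> (\<exists>y. f x < f y \<and> f y < r)"
    and lc: "\<forall>x r. f Zero < f x \<longrightarrow> (\<forall>y. f y < f x \<longrightarrow> (\<exists>y'. f y < f y' \<and> f y' < f x)) \<longrightarrow> r < f x
         \<longrightarrow> (\<exists>y. f y < f x \<and> r < f y)"
    using countable_preorder_embedding[of le Zero One, OF total trans bot top nontriv] by blast
  have f_less: "f c < f d \<longleftrightarrow> (\<forall>\<^sub>F n in U. val_at c n < val_at d n)" for c d
    using f_le[of d c] nle[of d c] by auto
  have f_eq: "f c = f d" if "\<forall>\<^sub>F n in U. val_at c n = val_at d n" for c d
    using that by (intro order_antisym) (auto simp: f_le le_def elim: eventually_mono)
  have f_bounds: "0 \<le> f c" "f c \<le> 1" for c
    using f_le[of Zero c] f_le[of c One] val_at_bounds by (auto simp: f_Zero f_One le_def)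
  \<comment> \<open>\<open>Mid\<close> terms make the order dense everywhere, which discharges the
    density premises of both continuity clauses.\<close>
  have dense: "\<exists>e. f c < f e \<and> f e < f d" if "f c < f d" for c d
    using that by (intro exI[of _ "Mid c d"]) (auto simp: f_less elim: eventually_mono)
  have rc: "\<exists>y. f x < f y \<and> f y < r" if "f x < 1" "f x < r" for x r
    using rc dense that f_One by simp
  have lc: "\<exists>y. f y < f x \<and> r < f y" if "0 < f x" "r < f x" for x r
    using lc dense that f_Zero by simp

  \<comment> \<open>The required type of worlds consists of functions on formulas. Terms are merely
    coded injectively as constant functions, which are not themselves the valuations.\<close>
  define \<iota> :: "world_term \<Rightarrow> fm \<Rightarrow> real" where "\<iota> w = (\<lambda>_. real (to_nat w))" for w
  have "inj \<iota>" by (auto simp: inj_def \<iota>_def fun_eq_iff)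
  define R where "R v w \<longleftrightarrow> (\<forall>\<^sub>F n in U. canonical_rel (stage n) (world v n) (world w n))" for v w
  define M :: "(fm \<Rightarrow> real) gk_model" where
    "M = \<lparr>worlds = range \<iota>, rel = (\<lambda>x y. if R (inv \<iota> x) (inv \<iota> y) then 1 else 0),
       val = (\<lambda>x p. f (Val (inv \<iota> x) (Var p)))\<rparr>"
  have gk: "is_gk_model M" and cr: "crisp M"
    using f_bounds by (auto simp: M_def is_gk_model_def crisp_def)
  have M_worlds: "worlds M = range \<iota>" "\<iota> v \<in> worlds M" for v by (auto simp: M_def)
  have M_rel: "rel M (\<iota> v) (\<iota> w) = 1 \<longleftrightarrow> R v w" for v w
    using \<open>inj \<iota>\<close> by (simp add: M_def)
  have succ: "R v w \<and> (\<forall>\<^sub>F n in U. p n (world w n))"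
    if "\<And>n. world w n = pick n (world v n) (p n)"
      "\<forall>\<^sub>F n in U. \<exists>g. logic_hom L g \<and> canonical_rel (stage n) (world v n) g \<and> p n g" for v w p
  proof -
    have "\<forall>\<^sub>F n in U. canonical_rel (stage n) (world v n) (world w n) \<and> p n (world w n)"
      using that(2) by eventually_elim (simp add: that(1) pick)
    then show ?thesis unfolding R_def by (auto simp: eventually_conj_iff)
  qed
  have truth: "\<phi> \<in> Lang \<Longrightarrow> eval M \<phi> (\<iota> v) = f (Val v \<phi>)" for \<phi> v
  proof (induction \<phi> arbitrary: v)
    case (Var p)
    then show ?case using \<open>inj \<iota>\<close> by (simp add: M_def)
  next
    case Bot
    have "f (Val v \<^bold>\<bottom>) = f Zero" by (rule f_eq) (simp add: goedel_hom_simps[OF goedel_hom_world])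
    then show ?case by (simp add: f_Zero)
  next
    case (And \<phi> \<psi>)
    have "f (Val v (\<phi> \<^bold>\<and> \<psi>)) = min (f (Val v \<phi>)) (f (Val v \<psi>))"
    proof (cases "f (Val v \<phi>) \<le> f (Val v \<psi>)")
      case True
      then have "f (Val v (\<phi> \<^bold>\<and> \<psi>)) = f (Val v \<phi>)"
        by (intro f_eq) (auto simp: f_le le_def goedel_hom_simps[OF goedel_hom_world] min_def elim: eventually_mono)
      then show ?thesis using True by simp
    next
      case False
      then have "f (Val v (\<phi> \<^bold>\<and> \<psi>)) = f (Val v \<psi>)"
        by (intro f_eq) (auto simp: f_le nle goedel_hom_simps[OF goedel_hom_world] min_def elim: eventually_mono)
      then show ?thesis using False by simp
    qed
    then show ?case using And.IH closed(1)[OF And.prems] by simp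
  next
    case (Or \<phi> \<psi>)
    have "f (Val v (\<phi> \<^bold>\<or> \<psi>)) = max (f (Val v \<phi>)) (f (Val v \<psi>))"
    proof (cases "f (Val v \<phi>) \<le> f (Val v \<psi>)")
      case True
      then have "f (Val v (\<phi> \<^bold>\<or> \<psi>)) = f (Val v \<psi>)"
        by (intro f_eq) (auto simp: f_le le_def goedel_hom_simps[OF goedel_hom_world] max_def elim: eventually_mono)
      then show ?thesis using True by simp
    next
      case False
      then have "f (Val v (\<phi> \<^bold>\<or> \<psi>)) = f (Val v \<phi>)"
        by (intro f_eq) (auto simp: f_le nle goedel_hom_simps[OF goedel_hom_world] max_def elim: eventually_mono)
      then show ?thesis using False by simp
    qed
    then show ?case using Or.IH closed(2)[OF Or.prems] by simp
  next
    case (Imp \<phi> \<psi>)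
    have "f (Val v (\<phi> \<^bold>\<rightarrow> \<psi>)) = gimp (f (Val v \<phi>)) (f (Val v \<psi>))"
    proof (cases "f (Val v \<phi>) \<le> f (Val v \<psi>)")
      case True
      then have "f (Val v (\<phi> \<^bold>\<rightarrow> \<psi>)) = f One"
        by (intro f_eq) (auto simp: f_le le_def goedel_hom_simps[OF goedel_hom_world] gimp_def elim: eventually_mono)
      then show ?thesis using True by (simp add: gimp_def f_One)
    next
      case False
      then have "f (Val v (\<phi> \<^bold>\<rightarrow> \<psi>)) = f (Val v \<psi>)"
        by (intro f_eq) (auto simp: f_le nle goedel_hom_simps[OF goedel_hom_world] gimp_def elim: eventually_mono)
      then show ?thesis using False by (simp add: gimp_def)
    qed
    then show ?case using Imp.IH closed(3)[OF Imp.prems] by simp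
  next
    case (Box \<phi>)
    then have IH: "eval M \<phi> (\<iota> w) = f (Val w \<phi>)" for w using closed(4) by blast
    let ?x = "Val v (\<^bold>\<box> \<phi>)"
    have "f ?x \<le> eval M (\<^bold>\<box> \<phi>) (\<iota> v)"
    proof (rule le_eval_Box[OF gk cr])
      fix y assume "y \<in> worlds M" "rel M (\<iota> v) y = 1"
      then obtain w where y: "y = \<iota> w" and vw: "R v w" using M_worlds M_rel by auto
      from vw[unfolded R_def] U_stage[OF Box.prems] have "\<forall>\<^sub>F n in U. world v n (\<^bold>\<box> \<phi>) \<le> world w n \<phi>"
        by eventually_elim (auto simp: canonical_rel_def)
      then show "f ?x \<le> eval M \<phi> y" by (simp add: y IH f_le le_def)
    qed (simp_all add: M_worlds f_bounds)
    \<comment> \<open>Right continuity supplies a term \<open>c\<close> with \<open>f c\<close>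
      strictly inside a supposed gap. The successor \<open>Box_succ v \<phi> c\<close> then has a
      value of \<phi> below \<open>f c\<close>, contradicting the infimum. For \<diamond> left
      continuity and \<open>Dia_succ\<close> play these parts.\<close>
    moreover have "\<not> f ?x < eval M (\<^bold>\<box> \<phi>) (\<iota> v)"
    proof
      assume less: "f ?x < eval M (\<^bold>\<box> \<phi>) (\<iota> v)"
      also have "\<dots> \<le> 1" using eval_in_unit[OF gk M_worlds(2)] by (metis atLeastAtMost_iff)
      finally obtain c where c: "f ?x < f c" "f c < eval M (\<^bold>\<box> \<phi>) (\<iota> v)" using rc less by blast
      let ?w = "Box_succ v \<phi> c"
      have "R v ?w \<and> (\<forall>\<^sub>F n in U. world ?w n \<phi> < val_at c n)"
      proof (rule succ)
        show "\<forall>\<^sub>F n in U. \<exists>g. logic_hom L g \<and> canonical_rel (stage n) (world v n) g \<and> g \<phi> < val_at c n"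
          using c(1) unfolding f_less
          by eventually_elim (rule box_existence, use val_at_bounds Box.prems stage logic_hom_world in simp_all)
      qed simp
      then have "rel M (\<iota> v) (\<iota> ?w) = 1" "f (Val ?w \<phi>) < f c" by (auto simp: M_rel f_less)
      then show False
        using eval_Box_le[OF gk cr M_worlds(2) M_worlds(2), of v ?w \<phi>] c(2) by (simp add: IH del: eval.simps)
    qed
    ultimately show ?case by (simp del: eval.simps)
  next
    case (Dia \<phi>)
    then have IH: "eval M \<phi> (\<iota> w) = f (Val w \<phi>)" for w using closed(5) by blast
    let ?x = "Val v (\<^bold>\<diamond> \<phi>)"
    have "eval M (\<^bold>\<diamond> \<phi>) (\<iota> v) \<le> f ?x"
    proof (rule eval_Dia_le[OF gk cr])
      fix y assume "y \<in> worlds M" "rel M (\<iota> v) y = 1"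
      then obtain w where y: "y = \<iota> w" and vw: "R v w" using M_worlds M_rel by auto
      from vw[unfolded R_def] U_stage[OF Dia.prems] have "\<forall>\<^sub>F n in U. world w n \<phi> \<le> world v n (\<^bold>\<diamond> \<phi>)"
        by eventually_elim (auto simp: canonical_rel_def)
      then show "eval M \<phi> y \<le> f ?x" by (simp add: y IH f_le le_def)
    qed (simp_all add: M_worlds f_bounds)
    moreover have "\<not> eval M (\<^bold>\<diamond> \<phi>) (\<iota> v) < f ?x"
    proof
      assume less: "eval M (\<^bold>\<diamond> \<phi>) (\<iota> v) < f ?x"
      have "0 \<le> eval M (\<^bold>\<diamond> \<phi>) (\<iota> v)" using eval_in_unit[OF gk M_worlds(2)] by (metis atLeastAtMost_iff)
      also note less
      finally obtain c where c: "f c < f ?x" "eval M (\<^bold>\<diamond> \<phi>) (\<iota> v) < f c" using lc less by blast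
      let ?w = "Dia_succ v \<phi> c"
      have "R v ?w \<and> (\<forall>\<^sub>F n in U. val_at c n < world ?w n \<phi>)"
      proof (rule succ)
        show "\<forall>\<^sub>F n in U. \<exists>g. logic_hom L g \<and> canonical_rel (stage n) (world v n) g \<and> val_at c n < g \<phi>"
          using c(1) unfolding f_less
          by eventually_elim (rule dia_existence, use val_at_bounds stage logic_hom_world in simp_all)
      qed simp
      then have "rel M (\<iota> v) (\<iota> ?w) = 1" "f c < f (Val ?w \<phi>)" by (auto simp: M_rel f_less)
      then show False
        using le_eval_Dia[OF gk cr M_worlds(2) M_worlds(2), of v ?w \<phi>] c(2) by (simp add: IH del: eval.simps)
    qed
    ultimately show ?case by (simp del: eval.simps)
  qed
  show ?thesis
  proof (rule that[OF gk cr M_worlds(2)[of Root]], intro ballI, rule_tac [2] impI)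
    fix \<phi> assume \<phi>: "\<phi> \<in> Lang"
    have "root \<phi> = 1 \<or> root \<phi> < 1" using goedel_hom_simps(6)[of root \<phi>] root by (auto simp: logic_hom_def)
    then show "eval M \<phi> (\<iota> Root) = 1 \<longleftrightarrow> root \<phi> = 1"
      using f_eq[of "Val Root \<phi>" One] f_less[of "Val Root \<phi>" One] by (auto simp: truth[OF \<phi>] f_One)
  next
    assume dia1: "\<forall>h \<Omega> \<phi>. logic_hom L h \<longrightarrow> finite \<Omega> \<longrightarrow> \<Omega> \<subseteq> Lang \<longrightarrow> h (\<^bold>\<diamond> \<phi>) = 1
        \<longrightarrow> (\<exists>g. logic_hom L g \<and> canonical_rel \<Omega> h g \<and> g \<phi> = 1)"
    show "dia1_witnessed_on Lang M"
      unfolding dia1_witnessed_on_def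
    proof (intro ballI allI impI)
      fix x \<psi> assume x: "x \<in> worlds M" and \<psi>: "\<^bold>\<diamond> \<psi> \<in> Lang" and 1: "eval M (\<^bold>\<diamond> \<psi>) x = 1"
      then obtain v where v: "x = \<iota> v" using M_worlds by auto
      then have "f One \<le> f (Val v (\<^bold>\<diamond> \<psi>))" using truth[OF \<psi>] 1 f_One by simp
      \<comment> \<open>Value 1 in the limit is an eventual inequality with \<open>One\<close>, so
        \<diamond>\<psi> is exactly 1 at eventually all stages, and witnesses chosen there give a
        witness in the limit.\<close>
      then have ev: "\<forall>\<^sub>F n in U. 1 \<le> world v n (\<^bold>\<diamond> \<psi>)" by (simp add: f_le le_def)
      let ?w = "Dia1_succ v \<psi>"
      have "R v ?w \<and> (\<forall>\<^sub>F n in U. world ?w n \<psi> = 1)"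
      proof (rule succ)
        show "\<forall>\<^sub>F n in U. \<exists>g. logic_hom L g \<and> canonical_rel (stage n) (world v n) g \<and> g \<psi> = 1"
          using ev
        proof eventually_elim
          case (elim n)
          then have "world v n (\<^bold>\<diamond> \<psi>) = 1"
            using goedel_hom_simps(6)[OF goedel_hom_world] by (intro order_antisym)
          then show ?case using stage logic_hom_world dia1 by blast
        qed
      qed simp
      then have "R v ?w" "f (Val ?w \<psi>) = f One" using f_eq[of "Val ?w \<psi>" One] by auto
      then show "\<exists>w\<in>worlds M. rel M x w = 1 \<and> eval M \<psi> w = 1"
        using M_worlds M_rel truth closed \<psi> f_One v by metis
    qed
  qed
qed

end

section \<open>Completeness\<close>

lemma finite_subfms: "finite (subfms \<phi>)"
  by (induction \<phi>) auto

lemma subfms_refl: "\<phi> \<in> subfms \<phi>"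
  by (cases \<phi>) auto

lemma subfms_trans: "\<psi> \<in> subfms \<phi> \<Longrightarrow> subfms \<psi> \<subseteq> subfms \<phi>"
  by (induction \<phi>) auto

section \<open>The canonical model over the subformulas of a formula\<close>

lemma canonical_model_simps:
  "worlds (canonical_model \<Omega>) = {h. logic_hom KG h}"
  "rel (canonical_model \<Omega>) h g = (if canonical_rel \<Omega> h g then 1 else 0)"
  "val (canonical_model \<Omega>) h p = h (Var p)"
  by (simp_all add: canonical_model_def logic_hom_def canonical_rel_def)

text \<open>In the modal cases the existence lemmas are applied with \<open>c\<close> equal to the
  evaluated modal formula; the successor obtained lies beyond the supposed infimum or
  supremum.\<close>

lemma canonical_model_truth:
  assumes "\<phi> \<in> subfms \<rho>" "logic_hom KG h"
  shows "eval (canonical_model (subfms \<rho>)) \<phi> h = h \<phi>"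
proof -
  let ?\<Omega> = "subfms \<rho>"
  let ?M = "canonical_model ?\<Omega>"
  have gs: "goedel_hom g" if "logic_hom KG g" for g using that by (simp add: logic_hom_def)
  have gk: "is_gk_model ?M" and cr: "crisp ?M"
    using assms(2) goedel_hom_simps(5,6)[OF gs]
    by (auto simp: is_gk_model_def crisp_def canonical_model_simps)
  show ?thesis using assms
  proof (induction \<phi> arbitrary: h)
    case (Box \<phi>)
    then have IH: "eval ?M \<phi> g = g \<phi>" if "logic_hom KG g" for g
      using subfms_trans[OF Box.prems(1)] subfms_refl that by auto
    note h = Box.prems(2)
    have w: "g \<in> worlds ?M \<longleftrightarrow> logic_hom KG g" for g by (simp add: canonical_model_simps)
    have "h (\<^bold>\<box> \<phi>) \<le> eval ?M (\<^bold>\<box> \<phi>) h"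
    proof (rule le_eval_Box[OF gk cr])
      fix g assume "g \<in> worlds ?M" "rel ?M h g = 1"
      then show "h (\<^bold>\<box> \<phi>) \<le> eval ?M \<phi> g"
        using Box.prems IH by (auto simp: canonical_model_simps canonical_rel_def split: if_splits)
    qed (use h w goedel_hom_simps(6)[OF gs[OF h]] in auto)
    moreover have "\<not> h (\<^bold>\<box> \<phi>) < eval ?M (\<^bold>\<box> \<phi>) h"
    proof
      assume *: "h (\<^bold>\<box> \<phi>) < eval ?M (\<^bold>\<box> \<phi>) h"
      have "eval ?M (\<^bold>\<box> \<phi>) h \<le> 1" using eval_in_unit[OF gk, of h "\<^bold>\<box> \<phi>"] h w by simp
      then obtain g where g: "logic_hom KG g" "canonical_rel ?\<Omega> h g" "g \<phi> < eval ?M (\<^bold>\<box> \<phi>) h"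
        using KG_box_existence[OF h finite_subfms _ *] by metis
      then show False
        using eval_Box_le[OF gk cr, of h g \<phi>] IH h w by (simp add: canonical_model_simps(2) del: eval.simps)
    qed
    ultimately show ?case by simp
  next
    case (Dia \<phi>)
    then have IH: "eval ?M \<phi> g = g \<phi>" if "logic_hom KG g" for g
      using subfms_trans[OF Dia.prems(1)] subfms_refl that by auto
    note h = Dia.prems(2)
    have w: "g \<in> worlds ?M \<longleftrightarrow> logic_hom KG g" for g by (simp add: canonical_model_simps)
    have "eval ?M (\<^bold>\<diamond> \<phi>) h \<le> h (\<^bold>\<diamond> \<phi>)"
    proof (rule eval_Dia_le[OF gk cr])
      fix g assume "g \<in> worlds ?M" "rel ?M h g = 1"
      then show "eval ?M \<phi> g \<le> h (\<^bold>\<diamond> \<phi>)"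
        using Dia.prems IH by (auto simp: canonical_model_simps canonical_rel_def split: if_splits)
    qed (use h w goedel_hom_simps(5)[OF gs[OF h]] in auto)
    moreover have "\<not> eval ?M (\<^bold>\<diamond> \<phi>) h < h (\<^bold>\<diamond> \<phi>)"
    proof
      assume *: "eval ?M (\<^bold>\<diamond> \<phi>) h < h (\<^bold>\<diamond> \<phi>)"
      have "0 \<le> eval ?M (\<^bold>\<diamond> \<phi>) h" using eval_in_unit[OF gk, of h "\<^bold>\<diamond> \<phi>"] h w by simp
      then obtain g where g: "logic_hom KG g" "canonical_rel ?\<Omega> h g" "eval ?M (\<^bold>\<diamond> \<phi>) h < g \<phi>"
        using KG_dia_existence[OF h finite_subfms _ *] by metis
      then show False
        using le_eval_Dia[OF gk cr, of h g \<phi>] IH h w by (simp add: canonical_model_simps(2) del: eval.simps)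
    qed
    ultimately show ?case by simp
  next
    case (And \<phi> \<psi>)
    have "\<phi> \<in> ?\<Omega>" "\<psi> \<in> ?\<Omega>" using subfms_trans[OF And.prems(1)] subfms_refl by auto
    then show ?case using And by (simp add: goedel_hom_simps[OF gs])
  next
    case (Or \<phi> \<psi>)
    have "\<phi> \<in> ?\<Omega>" "\<psi> \<in> ?\<Omega>" using subfms_trans[OF Or.prems(1)] subfms_refl by auto
    then show ?case using Or by (simp add: goedel_hom_simps[OF gs])
  next
    case (Imp \<phi> \<psi>)
    have "\<phi> \<in> ?\<Omega>" "\<psi> \<in> ?\<Omega>" using subfms_trans[OF Imp.prems(1)] subfms_refl by auto
    then show ?case using Imp by (simp add: goedel_hom_simps[OF gs])
  qed (simp_all add: canonical_model_simps goedel_hom_simps[OF gs])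
qed

lemma canonical_model_dia1_witnessed:
  "dia1_witnessed_on (subfms \<rho>) (canonical_model (subfms \<rho>))"
  unfolding dia1_witnessed_on_def
proof (intro ballI allI impI)
  let ?M = "canonical_model (subfms \<rho>)"
  fix h \<psi> assume h: "h \<in> worlds ?M" and \<psi>: "\<^bold>\<diamond> \<psi> \<in> subfms \<rho>" and 1: "eval ?M (\<^bold>\<diamond> \<psi>) h = 1"
  have lh: "logic_hom KG h" using h by (simp add: canonical_model_simps)
  have "h (\<^bold>\<diamond> \<psi>) = 1" using canonical_model_truth[OF \<psi> lh] 1 by simp
  from KG_dia1_existence[OF lh finite_subfms this]
  obtain g where "logic_hom KG g" "canonical_rel (subfms \<rho>) h g" "g \<psi> = 1" .
  moreover have "\<psi> \<in> subfms \<rho>" using subfms_trans[OF \<psi>] subfms_refl by auto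
  ultimately show "\<exists>w\<in>worlds ?M. rel ?M h w = 1 \<and> eval ?M \<psi> w = 1"
    by (intro bexI[of _ g]) (auto simp: canonical_model_simps canonical_model_truth)
qed

text \<open>The separating homomorphism, which settles all premises simultaneously, is taken as the
  root of the limit model over the full language.\<close>

lemma KG_complete:
  assumes "consequence (dia1_witnessed_crisp_models :: (fm \<Rightarrow> real) gk_model set) \<Gamma> \<phi>"
  shows "derives KG \<Gamma> \<phi>"
proof (rule ccontr)
  assume "\<not> derives KG \<Gamma> \<phi>"
  then obtain h where h: "logic_hom KG h" "\<forall>\<gamma>\<in>\<Gamma>. h \<gamma> = 1" "h \<phi> < 1"
    by (rule KG.hom_separation)
  interpret saturated_logic KG UNIV h
  proof
    show "\<exists>g. logic_hom KG g \<and> canonical_rel \<Omega> h g \<and> c < g \<phi>"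
      if "logic_hom KG h" "finite \<Omega>" "0 \<le> c" "c < h (\<^bold>\<diamond> \<phi>)" for h \<Omega> c \<phi>
      using KG_dia_existence[OF that] by metis
    show "\<exists>g. logic_hom KG g \<and> canonical_rel \<Omega> h g \<and> g \<phi> < c"
      if "logic_hom KG h" "finite \<Omega>" "c \<le> 1" "h (\<^bold>\<box> \<phi>) < c" for h \<Omega> c \<phi>
      using KG_box_existence[OF that] by metis
  qed (use h in auto)
  obtain M :: "(fm \<Rightarrow> real) gk_model" and v where M: "is_gk_model M" "crisp M" "v \<in> worlds M"
    "\<forall>\<phi>\<in>UNIV. eval M \<phi> v = 1 \<longleftrightarrow> h \<phi> = 1"
    and wit: "(\<forall>h \<Omega> \<phi>. logic_hom KG h \<longrightarrow> finite \<Omega> \<longrightarrow> \<Omega> \<subseteq> UNIV \<longrightarrow> h (\<^bold>\<diamond> \<phi>) = 1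
        \<longrightarrow> (\<exists>g. logic_hom KG g \<and> canonical_rel \<Omega> h g \<and> g \<phi> = 1)) \<longrightarrow> dia1_witnessed_on UNIV M"
    by (rule limit_model)
  have "dia1_witnessed_on UNIV M"
    using wit KG_dia1_existence by metis
  then have "M \<in> dia1_witnessed_crisp_models"
    using M by (simp add: dia1_witnessed_crisp_models_def)
  then show False using assms M h unfolding consequence_def by force
qed

lemma KG_dia_complete:
  assumes lang: "\<Gamma> \<subseteq> dia_language" "\<phi> \<in> dia_language"
    and cons: "consequence (dia1_witnessed_crisp_models :: (fm \<Rightarrow> real) gk_model set) \<Gamma> \<phi>"
  shows "derives KG_dia \<Gamma> \<phi>"
proof (rule ccontr)
  assume not: "\<not> derives KG_dia \<Gamma> \<phi>"
  have "box_free ` \<Gamma> = \<Gamma>" using lang box_free_id by force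
  then have "\<not> derives KG_dia_ext \<Gamma> \<phi>"
    using not derives_KG_dia_ext[of \<Gamma> \<phi>] box_free_id[OF lang(2)] by auto
  then obtain h where h: "logic_hom KG_dia_ext h" "\<forall>\<gamma>\<in>\<Gamma>. h \<gamma> = 1" "h \<phi> < 1"
    by (rule KG_dia.hom_separation)
  interpret saturated_logic KG_dia_ext dia_language h
  proof
    show "\<exists>g. logic_hom KG_dia_ext g \<and> canonical_rel \<Omega> h g \<and> c < g \<phi>"
      if "logic_hom KG_dia_ext h" "finite \<Omega>" "\<Omega> \<subseteq> dia_language" "0 \<le> c" "c < h (\<^bold>\<diamond> \<phi>)" for h \<Omega> c \<phi>
      using KG_dia_ext_dia_existence[OF that] by metis
  qed (use h in auto)
  obtain M :: "(fm \<Rightarrow> real) gk_model" and v where M: "is_gk_model M" "crisp M" "v \<in> worlds M"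
    "\<forall>\<phi>\<in>dia_language. eval M \<phi> v = 1 \<longleftrightarrow> h \<phi> = 1"
    by (rule limit_model)
  \<comment> \<open>\<open>M\<close> is crisp but not known to be witnessed, so \<open>cons\<close>
    is not applied to it directly: it yields a derivation in \<open>KG\<close>, which is sound for
    all crisp models.\<close>
  have "eval M \<phi> v = 1"
    by (rule derives_sound[OF M(1,2) KG_complete[OF cons] KG_sound[OF M(1,2)] M(3)])
      (use M(4) h(2) lang in auto)
  then show False using M(4) h(3) lang by auto
qed

lemma KG_sound_wrt: "sound_wrt KG UNIV (dia1_witnessed_crisp_models :: 'w gk_model set)"
  by (rule sound_wrt_dia1_witnessed_crisp_models) (rule KG_sound)

lemma KG_dia_sound_wrt:
  "sound_wrt KG_dia dia_language (dia1_witnessed_crisp_models :: 'w gk_model set)"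
  by (rule sound_wrt_dia1_witnessed_crisp_models) (rule KG_dia_sound)

lemma complete_wrtI:
  assumes "sound_wrt L Lang \<C>"
    "\<And>\<Gamma> \<phi>. \<Gamma> \<subseteq> Lang \<Longrightarrow> \<phi> \<in> Lang \<Longrightarrow> consequence \<C> \<Gamma> \<phi> \<Longrightarrow> derives L \<Gamma> \<phi>"
  shows "complete_wrt L Lang \<C>"
  using assms unfolding sound_wrt_def complete_wrt_def by blast

theorem theorem2:
  shows "sound_wrt KG UNIV (dia1_witnessed_crisp_models :: 'w gk_model set)
       \<and> complete_wrt KG UNIV (dia1_witnessed_crisp_models :: (fm \<Rightarrow> real) gk_model set)
       \<and> sound_wrt KG_dia dia_language (dia1_witnessed_crisp_models :: 'w gk_model set)
       \<and> complete_wrt KG_dia dia_language (dia1_witnessed_crisp_models :: (fm \<Rightarrow> real) gk_model set)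
       \<and> (\<forall>\<rho>. dia1_witnessed_on (subfms \<rho>) (canonical_model (subfms \<rho>)))"
  by (intro conjI allI KG_sound_wrt KG_dia_sound_wrt canonical_model_dia1_witnessed
      complete_wrtI KG_complete KG_dia_complete)

end
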